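(* Let $q$ be a prime power, let $\mathbb{F}_q[x]$ be the ring of polynomials over the finite field $\mathbb{F}_q$ with $q$ elements, and let $R=\mathbb{F}_q[x]/K$ be the quotient ring of $\mathbb{F}_q[x]$ modulo any ideal $K$. Let $\mathcal{S}_R$ be the multiplicative semigroup of the ring $R$ and let ${\rm U}(\mathcal{S}_R)$ be its group of units. Then $${\rm I}(\mathcal{S}_R)\geq {\rm D}({\rm U}(\mathcal{S}_R))+\Omega(K)-\omega(K),$$ where ${\rm I}$ denotes the Erdős–Burgess constant, ${\rm D}$ denotes the Davenport constant, $\Omega(K)$ is the number of prime ideals (repetitions are counted) and $\omega(K)$ the number of distinct prime ideals in the factorization when $K$ is factored into a product of prime ideals. Moreover, the equality $${\rm I}(\mathcal{S}_R)= {\rm D}({\rm U}(\mathcal{S}_R))+\Omega(K)-\omega(K)$$ holds for the case when $K$ is factored into either a power of some prime ideal or a product of some pairwise distinct prime ideals in $\mathbb{F}_q[x]$.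
   Context: Sequences are finite, and repetition of terms is allowed. Erdős–Burgess constant: let $\mathcal{S}$ be a nonempty commutative semigroup, written multiplicatively. An element $e\in\mathcal{S}$ is idempotent if $e\cdot e=e$. A sequence $T$ of terms from $\mathcal{S}$ is idempotent-product free if no nonempty subsequence of $T$ has the product of its terms equal to an idempotent of $\mathcal{S}$ (a subsequence is a sub-multiset of the terms; the order is irrelevant since $\mathcal{S}$ is commutative; the empty sequence is idempotent-product free). The Erdős–Burgess constant ${\rm I}(\mathcal{S})$ is the least $\ell\in\mathbb{N}\cup\{\infty\}$ such that every sequence of terms from $\mathcal{S}$ of length at least $\ell$ is not idempotent-product free; equivalently, ${\rm I}(\mathcal{S})=\sup\{|T|+1 : T \text{ is an idempotent-product free sequence of terms from } \mathcal{S}\}$. Davenport constant: for a finite abelian group $G$, ${\rm D}(G)$ is the smallest positive integer $\ell$ such that every sequence of terms from $G$ of length at least $\ell$ contains a nonempty subsequence the product of whose terms (the sum, if $G$ is written additively) is the identity element of $G$. $\mathcal{S}_R$ is the set $R$ with the ring multiplication, and ${\rm U}(\mathcal{S}_R)$ is the group of invertible elements of $R$. A nonzero proper ideal $K$ factors as $K=P_1^{n_1}\cdots P_r^{n_r}$ with $P_1,\dots,P_r$ distinct prime ideals and all $n_i\geq 1$; then $\Omega(K)=\sum_{i=1}^r n_i$ and $\omega(K)=r$. For $K=\mathbb{F}_q[x]$, $R$ is the zero ring, ${\rm I}(\mathcal{S}_R)=1$ and $\Omega(K)=\omega(K)=0$. For the zero ideal $K$, $R=\mathbb{F}_q[x]$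 and ${\rm I}(\mathcal{S}_R)=\infty$ (any sequence of nonconstant polynomials is idempotent-product free); the authors count this case as covered, remarking that the conclusion holds trivially there, and give no separate values of $\Omega$ and $\omega$ for it. *)

theory Defs
  imports
    "HOL-Algebra.Algebra"
    "HOL-Library.Extended_Nat"
    "HOL-Library.Multiset"
    "HOL-Number_Theory.Prime_Powers"
begin

text \<open>
  A commutative semigroup is given by the \<open>carrier\<close> and \<open>mult\<close> fields of a record; the
  field \<open>one\<close> is not used for the Erdos--Burgess constant. A sequence over it is a list
  of elements of the carrier, and its subsequences are the lists \<open>xs\<close> with
  \<open>mset xs \<subseteq># mset T\<close>.
\<close>

text \<open>The product of a nonempty list, bracketed to the right and without using a neutral
  element; the value on \<open>[]\<close> is meaningless.\<close>

definition seq_prod :: "('a, 'b) monoid_scheme \<Rightarrow> 'a list \<Rightarrow> 'a" where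
  "seq_prod G xs = foldr (\<lambda>x y. x \<otimes>\<^bsub>G\<^esub> y) (butlast xs) (last xs)"

definition idempotent_product_free :: "('a, 'b) monoid_scheme \<Rightarrow> 'a list \<Rightarrow> bool" where
  "idempotent_product_free S T \<longleftrightarrow>
     \<not> (\<exists>xs. xs \<noteq> [] \<and> mset xs \<subseteq># mset T \<and>
            seq_prod S xs \<otimes>\<^bsub>S\<^esub> seq_prod S xs = seq_prod S xs)"

text \<open>The bound \<open>\<infinity>\<close> is vacuous, so the least element below always exists.\<close>

definition erdos_burgess :: "('a, 'b) monoid_scheme \<Rightarrow> enat" where
  "erdos_burgess S =
     (LEAST l. \<forall>T. set T \<subseteq> carrier S \<longrightarrow> l \<le> enat (length T) \<longrightarrow>
                   \<not> idempotent_product_free S T)"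

text \<open>Intended for finite abelian groups only, for which the least element exists.\<close>

definition davenport :: "('a, 'b) monoid_scheme \<Rightarrow> nat" where
  "davenport G =
     (LEAST l. 0 < l \<and>
        (\<forall>T. set T \<subseteq> carrier G \<longrightarrow> l \<le> length T \<longrightarrow>
             (\<exists>xs. xs \<noteq> [] \<and> mset xs \<subseteq># mset T \<and> seq_prod G xs = \<one>\<^bsub>G\<^esub>)))"

text \<open>\<open>A\<close> is the set of the distinct prime ideals \<open>P\<^sub>i\<close> and \<open>n P\<^sub>i\<close> the exponent of
  \<open>P\<^sub>i\<close> in \<open>K\<close>. Products and powers are those of the multiplicative monoid of ideals, whose
  neutral element is the unit ideal; the latter is thus the product over \<open>A = {}\<close>.\<close>

definition prime_ideal_factorization ::
  "('a, 'b) ring_scheme \<Rightarrow> 'a set \<Rightarrow> 'a set set \<Rightarrow> ('a set \<Rightarrow> nat) \<Rightarrow> bool" where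
  "prime_ideal_factorization R K A n \<longleftrightarrow>
     finite A \<and> (\<forall>P\<in>A. primeideal P R \<and> 1 \<le> n P) \<and>
     K = (\<Otimes>\<^bsub>ideals_set R\<^esub>P\<in>A. P [^]\<^bsub>ideals_set R\<^esub> n P)"

text \<open>In a Dedekind domain the next two numbers are well defined for every nonzero ideal.
  For the zero ideal (where factorizations are not unique) they are
  unspecified natural numbers.\<close>

definition ideal_Omega :: "('a, 'b) ring_scheme \<Rightarrow> 'a set \<Rightarrow> nat" where
  "ideal_Omega R K = (THE m. \<exists>A n. prime_ideal_factorization R K A n \<and> m = (\<Sum>P\<in>A. n P))"

definition ideal_omega :: "('a, 'b) ring_scheme \<Rightarrow> 'a set \<Rightarrow> nat" where
  "ideal_omega R K = (THE r. \<exists>A n. prime_ideal_factorization R K A n \<and> r = card A)"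

end

theory Submission
  imports Defs
begin

text \<open>
  Let \<open>K = P\<^sub>1\<^bsup>n\<^sub>1\<^esup> \<dots> P\<^sub>r\<^bsup>n\<^sub>r\<^esup>\<close> be nonzero and let \<open>p\<^sub>i\<close> generate \<open>P\<^sub>i\<close>. For the lower bound, extend a
  product-one free sequence of units of length \<open>D - 1\<close> by \<open>n\<^sub>i - 1\<close> copies of the class of each
  \<open>p\<^sub>i\<close>: a product that uses some \<open>p\<^sub>i\<close> has \<open>p\<^sub>i\<close>-valuation strictly between \<open>0\<close> and \<open>n\<^sub>i\<close>, whereas
  an idempotent \<open>e\<close> satisfies \<open>p\<^sub>i\<^bsup>n\<^sub>i\<^esup> | e (e - 1)\<close> with coprime factors. If \<open>K = P\<^bsup>n\<^esup>\<close>, every nonunit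
  lies in \<open>P\<close>, so \<open>n\<close> nonunits have product zero, and a sequence of length \<open>D + n - 1\<close> contains
  \<open>n\<close> nonunits or \<open>D\<close> units. If \<open>K\<close> is squarefree, the finite ring is reduced, so every \<open>x\<close>
  satisfies \<open>x\<^bsup>m+1\<^esup> = x\<close> for some \<open>m \<ge> 1\<close> and is a unit times an idempotent; the unit parts of a
  sequence of length \<open>D\<close> contain a product-one subsequence.
\<close>

section \<open>The two constants in commutative monoids\<close>

text \<open>\<open>seq_prod\<close> avoids a neutral element, which a semigroup may lack. In a
  monoid the fold that starts at the neutral element also covers \<open>[]\<close>, so the
  inductions below work with it instead.\<close>

lemma (in monoid) seq_prod_eq_foldr:
  assumes "xs \<noteq> []" "set xs \<subseteq> carrier G"
  shows "seq_prod G xs = foldr (\<otimes>) xs \<one>"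
proof -
  have "last xs \<in> carrier G" using assms by auto
  moreover have "foldr (\<otimes>) (butlast xs @ [last xs]) \<one> = foldr (\<otimes>) (butlast xs) (last xs \<otimes> \<one>)"
    by simp
  ultimately show ?thesis using assms(1) by (simp add: seq_prod_def)
qed

lemma (in comm_monoid) foldr_mult_append:
  assumes "set xs \<subseteq> carrier G" "set ys \<subseteq> carrier G"
  shows "foldr (\<otimes>) (xs @ ys) \<one> = foldr (\<otimes>) xs \<one> \<otimes> foldr (\<otimes>) ys \<one>"
  using assms by (induction xs) (auto simp: m_assoc)

lemma (in comm_monoid) foldr_mult_map_mult:
  assumes "\<And>x. x \<in> set xs \<Longrightarrow> f x \<in> carrier G" "\<And>x. x \<in> set xs \<Longrightarrow> g x \<in> carrier G"
  shows "foldr (\<otimes>) (map (\<lambda>x. f x \<otimes> g x) xs) \<one> =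
         foldr (\<otimes>) (map f xs) \<one> \<otimes> foldr (\<otimes>) (map g xs) \<one>"
  using assms
proof (induction xs)
  case (Cons a xs)
  have "set (map f xs) \<subseteq> carrier G" "set (map g xs) \<subseteq> carrier G" using Cons.prems by auto
  hence "foldr (\<otimes>) (map f xs) \<one> \<in> carrier G" "foldr (\<otimes>) (map g xs) \<one> \<in> carrier G"
    using multlist_closed by blast+
  thus ?case using Cons by (simp add: m_ac)
qed auto

lemma (in monoid) foldr_mult_replicate:
  "x \<in> carrier G \<Longrightarrow> foldr (\<otimes>) (replicate n x) \<one> = x [^] n"
  by (induction n) (auto simp: nat_pow_comm[of x _ 1, simplified])

lemma (in comm_monoid) foldr_mult_idempotent:
  assumes "set xs \<subseteq> carrier G" "\<And>x. x \<in> set xs \<Longrightarrow> x \<otimes> x = x"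
  shows "foldr (\<otimes>) xs \<one> \<otimes> foldr (\<otimes>) xs \<one> = foldr (\<otimes>) xs \<one>"
proof -
  have "foldr (\<otimes>) (map (\<lambda>x. x \<otimes> x) xs) \<one> = foldr (\<otimes>) xs \<one> \<otimes> foldr (\<otimes>) xs \<one>"
    using foldr_mult_map_mult[of xs "\<lambda>x. x" "\<lambda>x. x"] assms(1) by auto
  moreover have "map (\<lambda>x. x \<otimes> x) xs = xs" using assms(2) by (simp add: map_idI)
  ultimately show ?thesis by simp
qed

lemma subseteq_mset_set: "mset xs \<subseteq># mset ys \<Longrightarrow> set xs \<subseteq> set ys"
  by (metis set_mset_mono set_mset_mset)

section \<open>Attained minima and extremal sequences\<close>

lemma erdos_burgess_greater:
  assumes "set T \<subseteq> carrier S" "idempotent_product_free S T"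
  shows "enat (length T) < erdos_burgess S"
proof -
  let ?P = "\<lambda>l. \<forall>T. set T \<subseteq> carrier S \<longrightarrow> l \<le> enat (length T) \<longrightarrow> \<not> idempotent_product_free S T"
  \<comment> \<open>No list has infinite length, so \<open>?P\<close> holds at infinity and its
    least element satisfies it too.\<close>
  have "?P (erdos_burgess S)" unfolding erdos_burgess_def by (rule LeastI[of ?P \<infinity>]) auto
  thus ?thesis using assms by force
qed

lemma erdos_burgess_le:
  assumes "\<And>T. set T \<subseteq> carrier S \<Longrightarrow> l \<le> length T \<Longrightarrow> \<not> idempotent_product_free S T"
  shows "erdos_burgess S \<le> enat l"
  unfolding erdos_burgess_def by (rule Least_le) (use assms in auto)

lemma seq_prod_units_of: "seq_prod (units_of G) = seq_prod G"
  by (simp add: seq_prod_def fun_eq_iff units_of_def)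

lemma (in comm_group) long_seq_has_product_one:
  assumes "finite (carrier G)" "set T \<subseteq> carrier G" "card (carrier G) \<le> length T"
  shows "\<exists>xs. xs \<noteq> [] \<and> mset xs \<subseteq># mset T \<and> seq_prod G xs = \<one>"
proof -
  \<comment> \<open>Pigeonhole on the products of the prefixes of \<open>T\<close>, the empty one included.\<close>
  define f where "f i = foldr (\<otimes>) (take i T) \<one>" for i
  have sub: "set (take i T) \<subseteq> carrier G" "set (drop i T) \<subseteq> carrier G" for i
    using assms(2) set_take_subset set_drop_subset by fast+
  have "f ` {..length T} \<subseteq> carrier G" unfolding f_def using sub by blast
  hence "card (f ` {..length T}) < card {..length T}"
    using assms card_mono[of "carrier G" "f ` {..length T}"] by simp
  then obtain i j where ij: "i < j" "j \<le> length T" "f i = f j"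
    by (metis (no_types, lifting) atMost_iff inj_on_def linorder_neqE_nat pigeonhole)
  define xs where "xs = drop i (take j T)"
  have tj: "take j T = take i T @ xs"
    unfolding xs_def using ij by (metis append_take_drop_id min.absorb1 nat_less_le take_take)
  have xs: "xs \<noteq> []" "set xs \<subseteq> carrier G" using ij sub(1)[of j] unfolding tj by (auto simp: xs_def)
  have "mset T = mset (take j T) + mset (drop j T)" by (metis append_take_drop_id mset_append)
  hence "mset xs \<subseteq># mset T" unfolding tj by simp
  \<comment> \<open>The equal prefix products are compared so that the common prefix cancels and the
    block \<open>xs\<close> between them has product one.\<close>
  moreover have "f i \<otimes> \<one> = f i \<otimes> foldr (\<otimes>) xs \<one>"
    using ij(3) foldr_mult_append[OF sub(1)[of i] xs(2)] multlist_closed[OF sub(1)[of i]]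
    unfolding f_def tj by (simp del: foldr_append)
  hence "seq_prod G xs = \<one>"
    using xs sub by (simp add: seq_prod_eq_foldr f_def)
  ultimately show ?thesis using xs(1) by blast
qed

text \<open>The group order has the defining property by the pigeonhole lemma, so the
  \<open>LEAST\<close> in \<open>davenport\<close> is attained and inherits it.\<close>

lemma (in comm_group) davenport_seq:
  assumes "finite (carrier G)" "set T \<subseteq> carrier G" "davenport G \<le> length T"
  shows "\<exists>xs. xs \<noteq> [] \<and> mset xs \<subseteq># mset T \<and> seq_prod G xs = \<one>"
proof -
  let ?P = "\<lambda>l. 0 < l \<and> (\<forall>T. set T \<subseteq> carrier G \<longrightarrow> l \<le> length T \<longrightarrow>
             (\<exists>xs. xs \<noteq> [] \<and> mset xs \<subseteq># mset T \<and> seq_prod G xs = \<one>))"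
  have "?P (card (carrier G))"
    using long_seq_has_product_one[OF assms(1)] assms(1) by (metis card_gt_0_iff empty_iff one_closed)
  hence "?P (davenport G)" unfolding davenport_def by (rule LeastI)
  thus ?thesis using assms(2,3) by blast
qed

text \<open>By minimality the defining property fails one below the Davenport constant, and a
  counterexample there is the extremal sequence. When the constant is at most 1, the number below it
  is excluded by positivity alone, and the empty sequence serves.\<close>

lemma ex_product_one_free:
  "\<exists>T. set T \<subseteq> carrier G \<and> davenport G \<le> Suc (length T) \<and>
       (\<forall>xs. xs \<noteq> [] \<longrightarrow> mset xs \<subseteq># mset T \<longrightarrow> seq_prod G xs \<noteq> \<one>\<^bsub>G\<^esub>)"
proof (cases "davenport G \<le> 1")
  case True
  thus ?thesis by (intro exI[of _ "[]"]) auto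
next
  case False
  hence "\<not> (0 < davenport G - 1 \<and> (\<forall>T. set T \<subseteq> carrier G \<longrightarrow> davenport G - 1 \<le> length T \<longrightarrow>
             (\<exists>xs. xs \<noteq> [] \<and> mset xs \<subseteq># mset T \<and> seq_prod G xs = \<one>\<^bsub>G\<^esub>)))"
    unfolding davenport_def by (intro not_less_Least) auto
  thus ?thesis using False by fastforce
qed

section \<open>Two criteria for upper bounds\<close>

text \<open>A sequence that is long enough contains as many units as the Davenport constant, hence a
  subsequence with product one, or else \<open>n + 1\<close> nonunits, whose product is idempotent
  by assumption.\<close>

lemma (in comm_monoid) erdos_burgess_le_of_nonunits:
  assumes fin: "finite (carrier G)"
    and nonunits: "\<And>xs. set xs \<subseteq> carrier G - Units G \<Longrightarrow> Suc n \<le> length xs \<Longrightarrow>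
      seq_prod G xs \<otimes> seq_prod G xs = seq_prod G xs"
  shows "erdos_burgess G \<le> enat (davenport (units_of G) + n)"
proof (rule erdos_burgess_le)
  fix T assume T: "set T \<subseteq> carrier G" "davenport (units_of G) + n \<le> length T"
  interpret U: comm_group "units_of G" by (rule units_comm_group)
  have finU: "finite (carrier (units_of G))"
    using fin by (auto simp: units_of_def Units_def)
  define us where "us = filter (\<lambda>x. x \<in> Units G) T"
  define ns where "ns = filter (\<lambda>x. x \<notin> Units G) T"
  have mset: "mset us \<subseteq># mset T" "mset ns \<subseteq># mset T" by (auto simp: us_def ns_def mset_filter)
  have "length us + length ns = length T"
    unfolding us_def ns_def by (rule sum_length_filter_compl)
  hence "davenport (units_of G) \<le> length us \<or> Suc n \<le> length ns" using T(2) by linarith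
  thus "\<not> idempotent_product_free G T"
  proof
    assume "davenport (units_of G) \<le> length us"
    moreover have "set us \<subseteq> carrier (units_of G)" by (auto simp: us_def units_of_def)
    ultimately obtain xs where "xs \<noteq> []" "mset xs \<subseteq># mset us" "seq_prod G xs = \<one>"
      using U.davenport_seq[OF finU] by (auto simp: seq_prod_units_of units_of_one)
    thus ?thesis unfolding idempotent_product_free_def using mset(1)
      by (metis one_closed r_one subset_mset.order_trans)
  next
    assume len: "Suc n \<le> length ns"
    hence "ns \<noteq> []" by auto
    moreover have "set ns \<subseteq> carrier G - Units G" using T(1) by (auto simp: ns_def)
    ultimately show ?thesis
      unfolding idempotent_product_free_def using mset nonunits len by blast
  qed
qed

text \<open>If the unit parts of some terms multiply to one, the product of these terms is the
  product of their idempotent parts, and in a commutative monoid that is idempotent.\<close>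

lemma (in comm_monoid) erdos_burgess_le_of_unit_idempotent:
  assumes fin: "finite (carrier G)"
    and decomp: "\<And>x. x \<in> carrier G \<Longrightarrow> \<exists>u\<in>Units G. \<exists>e\<in>carrier G. e \<otimes> e = e \<and> x = u \<otimes> e"
  shows "erdos_burgess G \<le> enat (davenport (units_of G))"
proof (rule erdos_burgess_le)
  fix T assume T: "set T \<subseteq> carrier G" "davenport (units_of G) \<le> length T"
  interpret U: comm_group "units_of G" by (rule units_comm_group)
  have finU: "finite (carrier (units_of G))"
    using fin by (auto simp: units_of_def Units_def)
  obtain u e where ue: "\<And>x. x \<in> carrier G \<Longrightarrow> u x \<in> Units G"
      "\<And>x. x \<in> carrier G \<Longrightarrow> e x \<in> carrier G" "\<And>x. x \<in> carrier G \<Longrightarrow> e x \<otimes> e x = e x"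
      "\<And>x. x \<in> carrier G \<Longrightarrow> u x \<otimes> e x = x"
    using decomp by metis
  have "set (map u T) \<subseteq> carrier (units_of G)" using T ue(1) by (auto simp: units_of_def)
  then obtain ys where ys: "ys \<noteq> []" "mset ys \<subseteq># mset (map u T)" "seq_prod G ys = \<one>"
    using U.davenport_seq[OF finU, of "map u T"] T(2) by (auto simp: seq_prod_units_of units_of_one)
  \<comment> \<open>\<open>ys\<close> consists of unit parts and has to be lifted to terms of
    \<open>T\<close>. As \<open>u\<close> may identify different terms, the lift is made on
    multisets, and \<open>map u xs\<close> agrees with \<open>ys\<close> only up to order.\<close>
  obtain B C where BC: "mset T = B + C" "image_mset u B = mset ys"
    using ys(2) by (metis image_mset_eq_plusD mset_map mset_subset_eq_exists_conv)
  obtain xs where xs: "mset xs = B" using ex_mset by blast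
  have sub: "mset xs \<subseteq># mset T" using BC xs by simp
  have carr: "set xs \<subseteq> carrier G" using subseteq_mset_set[OF sub] T(1) by blast
  have carr_u: "set (map u xs) \<subseteq> carrier G" and carr_e: "set (map e xs) \<subseteq> carrier G"
    using carr ue(1,2) Units_closed by auto
  have perm: "mset (map u xs) = mset ys" using BC xs by simp
  have ne: "xs \<noteq> []" using perm ys(1) by auto
  have "set ys \<subseteq> carrier G" using carr_u perm by (metis set_mset_mset)
  hence "foldr (\<otimes>) (map u xs) \<one> = \<one>"
    using multlist_perm_cong[OF perm carr_u] seq_prod_eq_foldr[of ys] ys by simp
  moreover have "map (\<lambda>x. u x \<otimes> e x) xs = xs" using carr by (intro map_idI ue(4)) blast
  moreover have "foldr (\<otimes>) (map (\<lambda>x. u x \<otimes> e x) xs) \<one> =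
      foldr (\<otimes>) (map u xs) \<one> \<otimes> foldr (\<otimes>) (map e xs) \<one>"
    using carr_u carr_e by (intro foldr_mult_map_mult) auto
  ultimately have "foldr (\<otimes>) xs \<one> = foldr (\<otimes>) (map e xs) \<one>" using carr_e by simp
  moreover have "foldr (\<otimes>) (map e xs) \<one> \<otimes> foldr (\<otimes>) (map e xs) \<one> = foldr (\<otimes>) (map e xs) \<one>"
    using carr_e ue(3) carr by (intro foldr_mult_idempotent) auto
  ultimately show "\<not> idempotent_product_free G T"
    unfolding idempotent_product_free_def using ne sub seq_prod_eq_foldr[OF ne carr] by auto
qed

section \<open>Periodic powers and unit parts\<close>

lemma (in monoid) finite_pow_eq:
  assumes "finite (carrier G)" "x \<in> carrier G"
  obtains i m :: nat where "x [^] (i + Suc m) = x [^] i"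
proof -
  have "range (\<lambda>i::nat. x [^] i) \<subseteq> carrier G" using assms by auto
  hence "\<not> inj (\<lambda>i::nat. x [^] i)"
    using assms(1) by (metis finite_imageD infinite_UNIV_nat rev_finite_subset)
  then obtain i j :: nat where "i < j" "x [^] j = x [^] i"
    by (metis injI linorder_neqE_nat)
  thus ?thesis using that by (metis less_iff_Suc_add add_Suc_right)
qed

text \<open>The power \<open>e = x [^] Suc m\<close> is idempotent and fixes \<open>x\<close>.
  Writing the exponent as \<open>Suc (Suc m)\<close> keeps the cofactor \<open>x [^] m\<close>
  available even if \<open>x\<close> itself is idempotent, which is the case
  \<open>m = 0\<close>.\<close>

lemma (in cring) unit_idempotent_decomp:
  assumes x: "x \<in> carrier R" "x [^] Suc (Suc m) = x"
  shows "\<exists>u\<in>Units R. \<exists>e\<in>carrier R. e \<otimes> e = e \<and> x = u \<otimes> e"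
proof -
  define y where "y = x [^] m"
  define e where "e = y \<otimes> x"
  have y: "y \<in> carrier R" and e: "e \<in> carrier R" using x by (auto simp: y_def e_def)
  have xe: "x \<otimes> e = x" using x(2) x(1) y unfolding e_def y_def by (simp add: m_ac)
  have ee: "e \<otimes> e = e" using xe x y unfolding e_def by (metis m_assoc m_closed)
  \<comment> \<open>On the summand \<open>e R\<close> the element \<open>x\<close> is invertible with inverse \<open>y\<close>; on \<open>(1 - e) R\<close> use \<open>1\<close>.\<close>
  define u where "u = x \<oplus> (\<one> \<ominus> e)"
  define v where "v = y \<otimes> e \<oplus> (\<one> \<ominus> e)"
  have uv_carr: "u \<in> carrier R" "v \<in> carrier R" using x y e by (auto simp: u_def v_def)
  \<comment> \<open>The expansion is grouped so that \<open>x \<otimes> e\<close> and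
    \<open>e \<ominus> e \<otimes> e\<close> occur as blocks, which \<open>xe\<close> and
    \<open>ee\<close> then evaluate.\<close>
  have "u \<otimes> v = (x \<otimes> e) \<otimes> y \<oplus> (x \<ominus> x \<otimes> e) \<oplus> y \<otimes> (e \<ominus> e \<otimes> e) \<oplus> (\<one> \<ominus> e) \<ominus> (e \<ominus> e \<otimes> e)"
    unfolding u_def v_def using x y e by algebra
  also have "\<dots> = y \<otimes> x \<oplus> (\<one> \<ominus> e)"
    unfolding xe ee using x y e by algebra
  also have "\<dots> = \<one>" unfolding e_def using x y by algebra
  finally have "u \<in> Units R" using uv_carr unfolding Units_def by (metis (mono_tags, lifting) m_comm mem_Collect_eq)
  moreover have "u \<otimes> e = x \<otimes> e \<oplus> (e \<ominus> e \<otimes> e)" unfolding u_def using x e by algebra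
  hence "u \<otimes> e = x" unfolding xe ee using x e by (simp add: minus_eq r_neg)
  ultimately show ?thesis using e ee by metis
qed

section \<open>Prime ideal factorization in principal domains\<close>

context cring
begin

lemma mult_ideals_set: "I \<otimes>\<^bsub>ideals_set R\<^esub> J = ideal_prod R I J"
  and one_ideals_set: "\<one>\<^bsub>ideals_set R\<^esub> = carrier R"
  and carrier_ideals_set: "carrier (ideals_set R) = {I. ideal I R}"
  by (simp_all add: ideals_set_def)

lemma cgenideal_mem_iff: "x \<in> PIdl a \<longleftrightarrow> (\<exists>r\<in>carrier R. x = r \<otimes> a)"
  unfolding cgenideal_def by auto

lemma cgenideal_one: "PIdl \<one> = carrier R"
  using ideal_eq_carrier_iff[of \<one>] by simp

lemma cgenideal_zero: "PIdl \<zero> = {\<zero>}"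
  unfolding cgenideal_def by force

lemma cgenideal_mult:
  assumes "a \<in> carrier R" "b \<in> carrier R"
  shows "PIdl a \<otimes>\<^bsub>ideals_set R\<^esub> PIdl b = PIdl (a \<otimes> b)"
proof -
  have I: "ideal (PIdl (a \<otimes> b)) R" using assms by (simp add: cgenideal_ideal)
  hence "Idl (PIdl (a \<otimes> b)) = PIdl (a \<otimes> b)"
    by (meson additive_subgroup.a_subset genideal_minimal genideal_self ideal.axioms(1) subset_antisym subset_refl)
  thus ?thesis
    using ideal_prod_eq_genideal[of "PIdl a" "PIdl b"] assms
    by (simp add: mult_ideals_set cgenideal_ideal cgenideal_prod)
qed

lemma cgenideal_pow:
  assumes "a \<in> carrier R"
  shows "PIdl a [^]\<^bsub>ideals_set R\<^esub> (n::nat) = PIdl (a [^] n)"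
proof (induction n)
  case 0
  thus ?case by (simp add: one_ideals_set cgenideal_one)
next
  case (Suc n)
  thus ?case using assms by (simp add: cgenideal_mult)
qed

lemma cgenideal_finprod:
  assumes "finite A" "\<And>x. x \<in> A \<Longrightarrow> g x \<in> carrier R"
  shows "(\<Otimes>\<^bsub>ideals_set R\<^esub>x\<in>A. PIdl (g x)) = PIdl (\<Otimes>x\<in>A. g x)"
proof -
  interpret I: comm_monoid "ideals_set R" by (rule ideals_set_is_comm_monoid)
  show ?thesis
    using assms
  proof (induction A rule: finite_induct)
    case empty
    thus ?case by (simp add: one_ideals_set cgenideal_one)
  next
    case (insert x A)
    have "(\<lambda>x. PIdl (g x)) \<in> A \<rightarrow> carrier (ideals_set R)" "PIdl (g x) \<in> carrier (ideals_set R)"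
      using insert.prems by (auto simp: carrier_ideals_set cgenideal_ideal)
    moreover have "g \<in> A \<rightarrow> carrier R" "g x \<in> carrier R" using insert.prems by auto
    ultimately show ?case using insert by (simp add: cgenideal_mult)
  qed
qed

lemma primeideal_pow_notin:
  assumes "primeideal P R" "a \<in> carrier R" "a \<notin> P"
  shows "a [^] (n::nat) \<notin> P"
proof (induction n)
  case 0
  interpret primeideal P R by fact
  show ?case using one_imp_carrier I_notcarr by auto
next
  case (Suc n)
  thus ?case using primeideal.I_prime[OF assms(1), of "a [^] n" a] assms(2,3) by auto
qed

lemma primeideal_finprod_notin:
  assumes "primeideal P R" "finite A" "\<And>x. x \<in> A \<Longrightarrow> f x \<in> carrier R" "\<And>x. x \<in> A \<Longrightarrow> f x \<notin> P"
  shows "(\<Otimes>x\<in>A. f x) \<notin> P"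
  using assms(2-)
proof (induction A rule: finite_induct)
  case empty
  interpret primeideal P R by fact
  show ?case using one_imp_carrier I_notcarr by auto
next
  case (insert x A)
  have "f \<in> A \<rightarrow> carrier R" "f x \<in> carrier R" using insert.prems by auto
  thus ?case using primeideal.I_prime[OF assms(1), of "f x" "finprod R f A"] insert by auto
qed

end

lemma (in domain) nat_pow_nonzero:
  "a \<in> carrier R \<Longrightarrow> a \<noteq> \<zero> \<Longrightarrow> a [^] (n::nat) \<noteq> \<zero>"
  by (induction n) (auto simp: integral_iff)

section \<open>Membership in prime powers as a valuation\<close>

context principal_domain
begin

text \<open>A generator of a nonzero prime ideal is irreducible, so the ideal is maximal and has no
  proper prime ideal above it.\<close>

lemma primeideal_subset_eq:
  assumes "primeideal P R" "P \<noteq> {\<zero>}" "primeideal Q R" "P \<subseteq> Q"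
  shows "P = Q"
proof -
  obtain p where p: "p \<in> carrier R" "P = PIdl p"
    using exists_gen primeideal.axioms(1)[OF assms(1)] by blast
  hence "p \<noteq> \<zero>" using assms(2) cgenideal_zero by auto
  hence "ring_prime p" using primeideal_iff_prime[of p] p assms(1) by auto
  hence max: "maximalideal P R"
    using primeness_condition[OF p(1)] irreducible_imp_maximalideal[OF p(1)] p(2) by auto
  have Q: "ideal Q R" "Q \<noteq> carrier R"
    using primeideal.axioms(1)[OF assms(3)] primeideal.I_notcarr[OF assms(3)] by auto
  show ?thesis using maximalideal.I_maximal[OF max Q(1) assms(4)] Q ideal.Icarr[OF Q(1)] by blast
qed

text \<open>Separates distinct primes: otherwise one would contain the other. It supplies the
  cofactors prime to \<open>p\<close> in all later cancellations.\<close>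

lemma prime_generator_notin:
  assumes q: "primeideal (PIdl q) R" "q \<in> carrier R" "q \<noteq> \<zero>"
    and P: "primeideal P R" "PIdl q \<noteq> P"
  shows "q \<notin> P"
proof
  assume "q \<in> P"
  hence "PIdl q \<subseteq> P" by (rule cgenideal_minimal[OF primeideal.axioms(1)[OF P(1)]])
  moreover have "PIdl q \<noteq> {\<zero>}" using q(2,3) cgenideal_self by blast
  ultimately show False using primeideal_subset_eq q(1) P by blast
qed

text \<open>A factor outside the prime does not change the valuation. The induction removes one
  \<open>p\<close> at a time: \<open>p\<close> divides \<open>a \<otimes> b\<close> but not
  \<open>b\<close>, hence it divides \<open>a\<close>, and cancelling it in the domain lowers the
  exponent.\<close>

lemma prime_power_mem_cancel:
  assumes p: "primeideal (PIdl p) R" "p \<in> carrier R" "p \<noteq> \<zero>"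
    and b: "b \<in> carrier R" "b \<notin> PIdl p"
  shows "a \<in> carrier R \<Longrightarrow> a \<otimes> b \<in> PIdl (p [^] (n::nat)) \<Longrightarrow> a \<in> PIdl (p [^] n)"
proof (induction n arbitrary: a)
  case 0
  thus ?case by (simp add: cgenideal_one)
next
  case (Suc n)
  obtain r where r: "r \<in> carrier R" "a \<otimes> b = r \<otimes> p [^] Suc n"
    using Suc.prems(2) by (auto simp: cgenideal_mem_iff)
  have ab: "a \<otimes> b = (r \<otimes> p [^] n) \<otimes> p" using r p(2) by (simp add: m_assoc)
  hence "a \<otimes> b \<in> PIdl p" using r p(2) by (auto simp: cgenideal_mem_iff)
  hence "a \<in> PIdl p" using primeideal.I_prime[OF p(1) Suc.prems(1) b(1)] b(2) by blast
  then obtain c where c: "c \<in> carrier R" "a = c \<otimes> p" by (auto simp: cgenideal_mem_iff)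
  have "(c \<otimes> b) \<otimes> p = (r \<otimes> p [^] n) \<otimes> p"
    using ab c b(1) p(2) by (simp add: m_ac)
  hence "c \<otimes> b = r \<otimes> p [^] n" using m_rcancel[of p] p(2,3) c b(1) r by auto
  hence "c \<in> PIdl (p [^] n)" using Suc.IH[OF c(1)] r by (auto simp: cgenideal_mem_iff)
  then obtain s where "s \<in> carrier R" "c = s \<otimes> p [^] n" by (auto simp: cgenideal_mem_iff)
  hence "a = s \<otimes> p [^] Suc n" using c(2) p(2) by (simp add: m_assoc)
  thus ?case using \<open>s \<in> carrier R\<close> by (auto simp: cgenideal_mem_iff)
qed

text \<open>The powers of a prime strictly decrease: if a lower power were a multiple of a higher
  one, cancelling it would make \<open>p\<close> divide one.\<close>

lemma prime_power_mem_iff: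
  assumes p: "primeideal (PIdl p) R" "p \<in> carrier R" "p \<noteq> \<zero>"
  shows "p [^] (m::nat) \<in> PIdl (p [^] (k::nat)) \<longleftrightarrow> k \<le> m"
proof
  assume "p [^] m \<in> PIdl (p [^] k)"
  then obtain r where r: "r \<in> carrier R" "p [^] m = r \<otimes> p [^] k" by (auto simp: cgenideal_mem_iff)
  show "k \<le> m"
  proof (rule ccontr)
    assume "\<not> k \<le> m"
    then obtain d where "k = m + Suc d" by (metis less_iff_Suc_add not_le add_Suc_right)
    hence "p [^] k = p [^] m \<otimes> p [^] Suc d" using p(2) by (simp only: nat_pow_mult)
    moreover have "p [^] m \<otimes> (r \<otimes> p [^] d \<otimes> p) = r \<otimes> (p [^] m \<otimes> p [^] Suc d)"
      using r(1) p(2) by (simp add: m_ac)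
    ultimately have "p [^] m \<otimes> (r \<otimes> p [^] d \<otimes> p) = p [^] m \<otimes> \<one>"
      using r p(2) by simp
    moreover have "p [^] m \<noteq> \<zero>" using p(2,3) by (rule nat_pow_nonzero)
    moreover have "p [^] m \<in> carrier R" "r \<otimes> p [^] d \<otimes> p \<in> carrier R" using p(2) r(1) by auto
    ultimately have "r \<otimes> p [^] d \<otimes> p = \<one>" using m_lcancel one_closed by blast
    moreover have "r \<otimes> p [^] d \<in> carrier R" using p(2) r(1) by simp
    ultimately have "\<one> \<in> PIdl p" unfolding cgenideal_mem_iff by metis
    thus False using p(1) ideal.one_imp_carrier primeideal.I_notcarr primeideal.axioms(1) by metis
  qed
next
  assume "k \<le> m"
  hence "p [^] m = p [^] (m - k) \<otimes> p [^] k" using p(2) by (simp add: nat_pow_mult)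
  thus "p [^] m \<in> PIdl (p [^] k)" using p(2) by (auto simp: cgenideal_mem_iff)
qed

text \<open>Passes from ideals to elements, where cancellation is available. No generator vanishes,
  since one zero factor would make \<open>K\<close> the zero ideal.\<close>

lemma factorization_generators:
  assumes "prime_ideal_factorization R K A n" "K \<noteq> {\<zero>}"
  obtains g where "\<And>P. P \<in> A \<Longrightarrow> g P \<in> carrier R" "\<And>P. P \<in> A \<Longrightarrow> g P \<noteq> \<zero>"
    "\<And>P. P \<in> A \<Longrightarrow> P = PIdl (g P)" "K = PIdl (\<Otimes>P\<in>A. g P [^] n P)"
proof -
  have fin: "finite A" and A: "\<And>P. P \<in> A \<Longrightarrow> primeideal P R \<and> 1 \<le> n P"
    and K: "K = (\<Otimes>\<^bsub>ideals_set R\<^esub>P\<in>A. P [^]\<^bsub>ideals_set R\<^esub> n P)"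
    using assms(1) unfolding prime_ideal_factorization_def by auto
  have "\<forall>P\<in>A. \<exists>a\<in>carrier R. P = PIdl a"
    using A exists_gen primeideal.axioms(1) by blast
  then obtain g where g: "\<And>P. P \<in> A \<Longrightarrow> g P \<in> carrier R" "\<And>P. P \<in> A \<Longrightarrow> P = PIdl (g P)"
    by metis
  interpret I: comm_monoid "ideals_set R" by (rule ideals_set_is_comm_monoid)
  have "P [^]\<^bsub>ideals_set R\<^esub> n P = PIdl (g P [^] n P)" if "P \<in> A" for P
    using cgenideal_pow[of "g P" "n P"] g that by simp
  hence "K = (\<Otimes>\<^bsub>ideals_set R\<^esub>P\<in>A. PIdl (g P [^] n P))"
    unfolding K using g(1) by (intro I.finprod_cong') (auto simp: carrier_ideals_set cgenideal_ideal)
  hence K': "K = PIdl (\<Otimes>P\<in>A. g P [^] n P)"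
    using cgenideal_finprod[OF fin, of "\<lambda>P. g P [^] n P"] g(1) by simp
  have "g P \<noteq> \<zero>" if P: "P \<in> A" for P
  proof
    assume "g P = \<zero>"
    \<comment> \<open>This needs a positive exponent, since the zeroth power of zero is one.\<close>
    hence "g P [^] n P = \<zero>" using A[OF P] by (simp add: nat_pow_zero)
    moreover have "(\<Otimes>P\<in>A. g P [^] n P) = (\<Otimes>P\<in>insert P (A - {P}). g P [^] n P)"
      using P by (simp add: insert_absorb)
    hence "(\<Otimes>P\<in>A. g P [^] n P) = g P [^] n P \<otimes> (\<Otimes>P\<in>A - {P}. g P [^] n P)"
      using fin g(1) P by (subst (asm) finprod_insert) auto
    moreover have "(\<Otimes>P\<in>A - {P}. g P [^] n P) \<in> carrier R" using g(1) by (intro finprod_closed) auto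
    ultimately have "K = {\<zero>}" using K' cgenideal_zero by simp
    thus False using assms(2) by blast
  qed
  thus ?thesis using that g K' by blast
qed

text \<open>The cofactor \<open>c\<close> collects the powers of the other primes, none of which
  lies in \<open>PIdl p\<close>. The exponent is 0 for a prime that does not occur in
  \<open>A\<close>.\<close>

lemma factorization_local:
  assumes fact: "prime_ideal_factorization R K A n" and K: "K \<noteq> {\<zero>}"
    and p: "primeideal (PIdl p) R" "p \<in> carrier R" "p \<noteq> \<zero>"
  obtains c where "c \<in> carrier R" "c \<notin> PIdl p"
    "K = PIdl (p [^] (if PIdl p \<in> A then n (PIdl p) else 0) \<otimes> c)"
proof -
  have fin: "finite A" and A: "\<And>P. P \<in> A \<Longrightarrow> primeideal P R \<and> 1 \<le> n P"
    using fact unfolding prime_ideal_factorization_def by auto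
  obtain g where g: "\<And>P. P \<in> A \<Longrightarrow> g P \<in> carrier R" "\<And>P. P \<in> A \<Longrightarrow> g P \<noteq> \<zero>"
    "\<And>P. P \<in> A \<Longrightarrow> P = PIdl (g P)" and Kg: "K = PIdl (\<Otimes>P\<in>A. g P [^] n P)"
    using factorization_generators[OF fact K] by blast
  let ?P = "PIdl p"
  define c where "c = (\<Otimes>Q\<in>A - {?P}. g Q [^] n Q)"
  have c: "c \<in> carrier R" unfolding c_def using g(1) by (intro finprod_closed) auto
  have "g Q [^] n Q \<notin> ?P" if "Q \<in> A - {?P}" for Q
  proof (rule primeideal_pow_notin[OF p(1)])
    show "g Q \<in> carrier R" using g(1) that by blast
    show "g Q \<notin> ?P"
      using prime_generator_notin[of "g Q" ?P] g(1-3)[of Q] A[of Q] p(1) that by auto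
  qed
  hence cP: "c \<notin> ?P"
    unfolding c_def using p(1) fin g(1) by (intro primeideal_finprod_notin) auto
  show ?thesis
  proof (cases "?P \<in> A")
    case True
    have "(\<Otimes>P\<in>A. g P [^] n P) = (\<Otimes>P\<in>insert ?P (A - {?P}). g P [^] n P)"
      using True by (simp add: insert_absorb)
    hence "(\<Otimes>P\<in>A. g P [^] n P) = g ?P [^] n ?P \<otimes> c"
      using fin g(1) True by (subst (asm) finprod_insert) (auto simp: c_def)
    \<comment> \<open>The chosen generator \<open>g ?P\<close> may differ from \<open>p\<close>, so
      the replacement is made between ideals, not between elements.\<close>
    moreover have "PIdl (g ?P [^] n ?P) = PIdl (p [^] n ?P)"
      using cgenideal_pow[of p "n ?P"] cgenideal_pow[of "g ?P" "n ?P"] g(1,3)[OF True] p(2) by simp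
    hence "PIdl (g ?P [^] n ?P \<otimes> c) = PIdl (p [^] n ?P \<otimes> c)"
      using cgenideal_mult[of "g ?P [^] n ?P" c] cgenideal_mult[of "p [^] n ?P" c] c p(2) g(1)[OF True]
      by simp
    ultimately show ?thesis using that[OF c cP] True Kg by simp
  next
    case False
    hence "A - {?P} = A" by blast
    thus ?thesis using that[OF c cP] False Kg c by (simp add: c_def)
  qed
qed

text \<open>Describes the exponent of a prime through \<open>K\<close> alone, as the largest
  \<open>k\<close> for which the \<open>k\<close>-th power of the prime contains \<open>K\<close>.
  Uniqueness rests on this.\<close>

lemma factorization_subset_iff:
  assumes fact: "prime_ideal_factorization R K A n" and K: "K \<noteq> {\<zero>}"
    and p: "primeideal (PIdl p) R" "p \<in> carrier R" "p \<noteq> \<zero>"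
  shows "K \<subseteq> PIdl (p [^] k) \<longleftrightarrow> k \<le> (if PIdl p \<in> A then n (PIdl p) else 0)"
proof -
  let ?v = "if PIdl p \<in> A then n (PIdl p) else 0"
  obtain c where c: "c \<in> carrier R" "c \<notin> PIdl p" and Kc: "K = PIdl (p [^] ?v \<otimes> c)"
    using factorization_local[OF assms] by blast
  show ?thesis
  proof
    assume "K \<subseteq> PIdl (p [^] k)"
    hence "p [^] ?v \<otimes> c \<in> PIdl (p [^] k)" using Kc cgenideal_self[of "p [^] ?v \<otimes> c"] c p by auto
    hence "p [^] ?v \<in> PIdl (p [^] k)" using prime_power_mem_cancel[OF p c] p(2) by blast
    thus "k \<le> ?v" using prime_power_mem_iff[OF p] by blast
  next
    assume "k \<le> ?v"
    then obtain r where r: "r \<in> carrier R" "p [^] ?v = r \<otimes> p [^] k"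
      using prime_power_mem_iff[OF p] unfolding cgenideal_mem_iff by blast
    hence "p [^] ?v \<otimes> c = (r \<otimes> c) \<otimes> p [^] k" using p(2) c by (simp add: m_ac)
    hence "p [^] ?v \<otimes> c \<in> PIdl (p [^] k)"
      unfolding cgenideal_mem_iff using r(1) c by (intro bexI[of _ "r \<otimes> c"]) auto
    thus "K \<subseteq> PIdl (p [^] k)"
      unfolding Kc using cgenideal_minimal[OF cgenideal_ideal] p(2) by auto
  qed
qed

section \<open>Uniqueness and existence of prime factorizations\<close>

lemma factorization_unique:
  assumes A: "prime_ideal_factorization R K A n" and B: "prime_ideal_factorization R K B m"
    and K: "K \<noteq> {\<zero>}"
  shows "A = B" "\<And>P. P \<in> A \<Longrightarrow> n P = m P"
proof -
  have *: "P \<in> B' \<and> n' P \<le> m' P"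
    if fA: "prime_ideal_factorization R K A' n'" and fB: "prime_ideal_factorization R K B' m'"
      and P: "P \<in> A'" for A' B' n' m' P
  proof -
    obtain g where g: "g P \<in> carrier R" "g P \<noteq> \<zero>" "P = PIdl (g P)"
      using factorization_generators[OF fA K] P by metis
    have P': "primeideal (PIdl (g P)) R" "1 \<le> n' P"
      using fA P g(3) unfolding prime_ideal_factorization_def by auto
    have "K \<subseteq> PIdl (g P [^] n' P)"
      using factorization_subset_iff[OF fA K P'(1) g(1,2), of "n' P"] P g(3) by auto
    hence "n' P \<le> (if PIdl (g P) \<in> B' then m' (PIdl (g P)) else 0)"
      using factorization_subset_iff[OF fB K P'(1) g(1,2)] by blast
    thus ?thesis using P'(2) g(3) by (auto split: if_splits)
  qed
  show AB: "A = B" using *[OF A B] *[OF B A] by blast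
  show "n P = m P" if "P \<in> A" for P
    using *[OF A B that] *[OF B A, of P] that AB by auto
qed

text \<open>By uniqueness the \<open>THE\<close> value can be read off from any factorization, so
  each case of the theorem may use the one that its hypothesis provides.\<close>

lemma ideal_Omega_eq:
  assumes "prime_ideal_factorization R K A n" "K \<noteq> {\<zero>}"
  shows "ideal_Omega R K = (\<Sum>P\<in>A. n P)"
  unfolding ideal_Omega_def
proof (rule the_equality)
  fix m assume "\<exists>A n. prime_ideal_factorization R K A n \<and> m = (\<Sum>P\<in>A. n P)"
  then obtain B l where B: "prime_ideal_factorization R K B l" "m = (\<Sum>P\<in>B. l P)" by blast
  show "m = (\<Sum>P\<in>A. n P)"
    using factorization_unique[OF assms(1) B(1) assms(2)] B(2) by (metis (mono_tags, lifting) sum.cong)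
qed (use assms in blast)

lemma ideal_omega_eq:
  assumes "prime_ideal_factorization R K A n" "K \<noteq> {\<zero>}"
  shows "ideal_omega R K = card A"
  unfolding ideal_omega_def
proof (rule the_equality)
  fix r assume "\<exists>A n. prime_ideal_factorization R K A n \<and> r = card A"
  thus "r = card A" using factorization_unique(1)[OF assms(1) _ assms(2)] by blast
qed (use assms in blast)

text \<open>A generator of \<open>K\<close> splits into irreducibles, which are prime here. Their
  ideals are inserted one by one, and repeated ones are merged into exponents.\<close>

lemma factorization_exists:
  assumes "ideal K R" "K \<noteq> {\<zero>}"
  obtains A n where "prime_ideal_factorization R K A n"
proof -
  obtain f where f: "f \<in> carrier R" "K = PIdl f" using exists_gen[OF assms(1)] by blast
  hence f0: "f \<noteq> \<zero>" using assms(2) cgenideal_zero by auto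
  interpret I: comm_monoid "ideals_set R" by (rule ideals_set_is_comm_monoid)
  have step: "\<exists>A n. prime_ideal_factorization R (PIdl (foldr (\<otimes>) fs \<one>)) A n"
    if "\<And>p. p \<in> set fs \<Longrightarrow> p \<in> carrier R \<and> primeideal (PIdl p) R" for fs
    using that
  proof (induction fs)
    case Nil
    have "prime_ideal_factorization R (PIdl (foldr (\<otimes>) [] \<one>)) {} (\<lambda>_. 1)"
      by (simp add: prime_ideal_factorization_def one_ideals_set cgenideal_one)
    thus ?case by blast
  next
    case (Cons p fs)
    then obtain A n where fact: "prime_ideal_factorization R (PIdl (foldr (\<otimes>) fs \<one>)) A n" by auto
    let ?P = "PIdl p"
    have fin: "finite A" and A: "\<And>P. P \<in> A \<Longrightarrow> primeideal P R \<and> 1 \<le> n P"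
      and K: "PIdl (foldr (\<otimes>) fs \<one>) = (\<Otimes>\<^bsub>ideals_set R\<^esub>P\<in>A. P [^]\<^bsub>ideals_set R\<^esub> n P)"
      using fact unfolding prime_ideal_factorization_def by auto
    have p: "p \<in> carrier R" "primeideal ?P R" "?P \<in> carrier (ideals_set R)"
      using Cons.prems by (auto simp: carrier_ideals_set primeideal.axioms(1))
    have Ac: "P \<in> carrier (ideals_set R)" if "P \<in> A" for P
      using A[OF that] by (simp add: carrier_ideals_set primeideal.axioms(1))
    \<comment> \<open>The previous exponent at the inserted prime, 0 if the prime is new; splitting
      off this prime treats both cases alike.\<close>
    define v where "v = (if ?P \<in> A then n ?P else 0)"
    define m where "m = n(?P := Suc v)"
    have mn: "(\<Otimes>\<^bsub>ideals_set R\<^esub>P\<in>A - {?P}. P [^]\<^bsub>ideals_set R\<^esub> m P) =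
        (\<Otimes>\<^bsub>ideals_set R\<^esub>P\<in>A - {?P}. P [^]\<^bsub>ideals_set R\<^esub> n P)" (is "_ = ?C")
      using Ac by (intro I.finprod_cong') (auto simp: m_def)
    have C: "?C \<in> carrier (ideals_set R)" using Ac by (intro I.finprod_closed) auto
    have "(\<Otimes>\<^bsub>ideals_set R\<^esub>P\<in>A. P [^]\<^bsub>ideals_set R\<^esub> n P) = ?P [^]\<^bsub>ideals_set R\<^esub> v \<otimes>\<^bsub>ideals_set R\<^esub> ?C"
    proof (cases "?P \<in> A")
      case True
      hence "A = insert ?P (A - {?P})" by blast
      hence "(\<Otimes>\<^bsub>ideals_set R\<^esub>P\<in>A. P [^]\<^bsub>ideals_set R\<^esub> n P) =
          (\<Otimes>\<^bsub>ideals_set R\<^esub>P\<in>insert ?P (A - {?P}). P [^]\<^bsub>ideals_set R\<^esub> n P)" by simp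
      thus ?thesis using True fin Ac p(3) by (subst (asm) I.finprod_insert) (auto simp: v_def)
    next
      case False
      thus ?thesis using C by (simp add: v_def)
    qed
    moreover have "(\<Otimes>\<^bsub>ideals_set R\<^esub>P\<in>insert ?P A. P [^]\<^bsub>ideals_set R\<^esub> m P) =
        (\<Otimes>\<^bsub>ideals_set R\<^esub>P\<in>insert ?P (A - {?P}). P [^]\<^bsub>ideals_set R\<^esub> m P)" by simp
    hence "(\<Otimes>\<^bsub>ideals_set R\<^esub>P\<in>insert ?P A. P [^]\<^bsub>ideals_set R\<^esub> m P) =
        ?P [^]\<^bsub>ideals_set R\<^esub> Suc v \<otimes>\<^bsub>ideals_set R\<^esub> ?C"
      using fin Ac p(3) mn by (subst (asm) I.finprod_insert) (auto simp: m_def)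
    ultimately have "(\<Otimes>\<^bsub>ideals_set R\<^esub>P\<in>insert ?P A. P [^]\<^bsub>ideals_set R\<^esub> m P) =
        ?P \<otimes>\<^bsub>ideals_set R\<^esub> PIdl (foldr (\<otimes>) fs \<one>)"
      using C p(3) K by (simp add: I.m_ac)
    also have "\<dots> = PIdl (foldr (\<otimes>) (p # fs) \<one>)"
      using cgenideal_mult[of p "foldr (\<otimes>) fs \<one>"] p(1) Cons.prems by (auto intro!: multlist_closed)
    finally have "prime_ideal_factorization R (PIdl (foldr (\<otimes>) (p # fs) \<one>)) (insert ?P A) m"
      using fin A p(2) by (auto simp: prime_ideal_factorization_def m_def)
    thus ?case by blast
  qed
  obtain fs where fs: "set fs \<subseteq> carrier (mult_of R)" "wfactors (mult_of R) fs f"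
    using mult_of.wfactors_exist[of f] f f0 by auto
  have "p \<in> carrier R \<and> primeideal (PIdl p) R" if "p \<in> set fs" for p
  proof -
    have "irreducible (mult_of R) p" "p \<in> carrier R - {\<zero>}" using fs that by (auto simp: wfactors_def)
    thus ?thesis
      using mult_of.irreducible_prime[of p] primeideal_iff_prime[of p] ring_primeI'[of p] by auto
  qed
  \<comment> \<open>The product of the irreducibles equals \<open>f\<close> only up to a unit, which
    does not change the principal ideal.\<close>
  moreover have "foldr (\<otimes>) fs \<one> \<sim>\<^bsub>mult_of R\<^esub> f" using fs(2) by (simp add: wfactors_def)
  moreover have c: "foldr (\<otimes>) fs \<one> \<in> carrier R" using fs(1) by (intro multlist_closed) auto
  ultimately show ?thesis
    using step[of fs] that f f0 associated_iff_same_ideal[OF c f(1)] assoc_iff_assoc_mult[OF c f(1)] by auto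
qed

end

section \<open>Quotients of principal domains\<close>

lemma (in ideal) Quot_one_eq: "\<one>\<^bsub>R Quot I\<^esub> = I +> \<one>"
  and Quot_zero_eq: "\<zero>\<^bsub>R Quot I\<^esub> = I"
  and Quot_mult_eq: "a \<in> carrier R \<Longrightarrow> b \<in> carrier R \<Longrightarrow>
    (I +> a) \<otimes>\<^bsub>R Quot I\<^esub> (I +> b) = I +> (a \<otimes> b)"
  and Quot_carrier_eq: "carrier (R Quot I) = (\<lambda>a. I +> a) ` carrier R"
  by (auto simp: FactRing_simps rcoset_mult_add)

lemma (in ideal) Quot_eq_iff:
  "a \<in> carrier R \<Longrightarrow> b \<in> carrier R \<Longrightarrow> I +> a = I +> b \<longleftrightarrow> a \<ominus> b \<in> I"
  using quotient_eq_iff_same_a_r_cos[OF is_ideal] by blast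

lemma (in ideal) Quot_pow_eq:
  "a \<in> carrier R \<Longrightarrow> (I +> a) [^]\<^bsub>R Quot I\<^esub> (n::nat) = I +> (a [^] n)"
  by (induction n) (auto simp: Quot_one_eq Quot_mult_eq)

text \<open>An inverse \<open>b\<close> would put \<open>a \<otimes> b \<ominus> \<one>\<close> into
  \<open>K\<close> and so into \<open>P\<close>; as \<open>a \<otimes> b\<close> lies in
  \<open>P\<close>, so would one.\<close>

lemma (in cring) Quot_notin_Units:
  assumes "ideal K R" "primeideal P R" "K \<subseteq> P" "a \<in> P"
  shows "K +> a \<notin> Units (R Quot K)"
proof
  interpret K: ideal K R by fact
  interpret P: primeideal P R by fact
  have a: "a \<in> carrier R" using assms(4) P.Icarr by blast
  assume "K +> a \<in> Units (R Quot K)"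
  then obtain b where b: "b \<in> carrier R" "K +> (a \<otimes> b) = K +> \<one>"
    using a by (auto simp: Units_def K.Quot_carrier_eq K.Quot_mult_eq K.Quot_one_eq)
  hence "a \<otimes> b \<ominus> \<one> \<in> P" using K.Quot_eq_iff a assms(3) by auto
  moreover have "a \<otimes> b \<in> P" using assms(4) b(1) by (rule P.I_r_closed)
  ultimately have "(a \<otimes> b) \<ominus> (a \<otimes> b \<ominus> \<one>) \<in> P"
    using P.a_closed P.a_inv_closed minus_eq by metis
  moreover have "(a \<otimes> b) \<ominus> (a \<otimes> b \<ominus> \<one>) = \<one>" using a b(1) by algebra
  ultimately show False using P.one_imp_carrier P.I_notcarr by simp
qed

text \<open>In a domain a nonzero idempotent is one, and a positive power of a nonzero nonunit is
  neither zero nor one. Constant sequences of every length are therefore free.\<close>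

lemma (in domain) erdos_burgess_Quot_zero:
  assumes x: "x \<in> carrier R" "x \<noteq> \<zero>" "x \<notin> Units R"
  shows "erdos_burgess (R Quot {\<zero>}) = \<infinity>"
proof (rule ccontr)
  interpret Z: ideal "{\<zero>}" R by (rule zeroideal)
  interpret Q: cring "R Quot {\<zero>}" by (rule Z.quotient_is_cring[OF is_cring])
  let ?x = "{\<zero>} +> x"
  assume "erdos_burgess (R Quot {\<zero>}) \<noteq> \<infinity>"
  then obtain l where l: "erdos_burgess (R Quot {\<zero>}) = enat l" by auto
  have xc: "?x \<in> carrier (R Quot {\<zero>})" using x(1) by (simp add: Z.Quot_carrier_eq)
  have "idempotent_product_free (R Quot {\<zero>}) (replicate l ?x)"
    unfolding idempotent_product_free_def
  proof safe
    fix xs :: "'a set list"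
    assume ne: "xs \<noteq> []" and sub: "mset xs \<subseteq># mset (replicate l ?x)"
      and idem: "seq_prod (R Quot {\<zero>}) xs \<otimes>\<^bsub>R Quot {\<zero>}\<^esub> seq_prod (R Quot {\<zero>}) xs =
        seq_prod (R Quot {\<zero>}) xs"
    obtain k where xs: "xs = replicate (Suc k) ?x"
      using subseteq_mset_set[OF sub] ne
      by (metis in_set_replicate length_0_conv not0_implies_Suc replicate_eqI subsetD)
    let ?y = "x [^] Suc k"
    have y: "?y \<in> carrier R" using x(1) by simp
    have "set xs \<subseteq> carrier (R Quot {\<zero>})" using xc xs by auto
    hence "seq_prod (R Quot {\<zero>}) xs = foldr (\<otimes>\<^bsub>R Quot {\<zero>}\<^esub>) xs \<one>\<^bsub>R Quot {\<zero>}\<^esub>"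
      by (rule Q.seq_prod_eq_foldr[OF ne])
    also have "\<dots> = ?x [^]\<^bsub>R Quot {\<zero>}\<^esub> Suc k"
      unfolding xs by (rule Q.foldr_mult_replicate[OF xc])
    also have "\<dots> = {\<zero>} +> ?y" using x(1) by (rule Z.Quot_pow_eq)
    finally have "{\<zero>} +> (?y \<otimes> ?y) = {\<zero>} +> ?y" using idem y by (simp only: Z.Quot_mult_eq)
    hence "?y \<otimes> ?y \<ominus> ?y = \<zero>" using Z.Quot_eq_iff[of "?y \<otimes> ?y" ?y] y by blast
    hence "?y \<otimes> ?y = ?y \<otimes> \<one>" using y by simp
    moreover have "?y \<noteq> \<zero>" using x(1,2) by (rule nat_pow_nonzero)
    ultimately have "?y = \<one>" using m_lcancel y one_closed by blast
    hence "x [^] k \<otimes> x = \<one>" by simp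
    hence "x \<in> Units R" using x(1) m_comm[of "x [^] k" x] unfolding Units_def by force
    thus False using x(3) by blast
  qed
  moreover have "set (replicate l ?x) \<subseteq> carrier (R Quot {\<zero>})" using xc by (simp add: subset_iff)
  ultimately have "enat l < erdos_burgess (R Quot {\<zero>})"
    using erdos_burgess_greater[of "replicate l ?x" "R Quot {\<zero>}"] by simp
  thus False using l by simp
qed

section \<open>The lower bound for nonzero ideals\<close>

context principal_domain
begin

text \<open>Provides a representative of a product whose valuation at \<open>p\<close> is exactly
  the number of terms equal to the class of \<open>p\<close>; the other representatives avoid the
  prime, and so does their product.\<close>

lemma Quot_prod_prime_split:
  assumes K: "ideal K R" and p: "primeideal (PIdl p) R" "p \<in> carrier R"
    and xs: "\<And>x. x \<in> set xs \<Longrightarrow> x \<noteq> K +> p \<Longrightarrow> \<exists>b\<in>carrier R - PIdl p. x = K +> b"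
  shows "\<exists>b\<in>carrier R - PIdl p.
    foldr (\<otimes>\<^bsub>R Quot K\<^esub>) xs \<one>\<^bsub>R Quot K\<^esub> = K +> (p [^] count_list xs (K +> p) \<otimes> b)"
  using xs
proof (induction xs)
  case Nil
  have "\<one> \<notin> PIdl p" using p(1) ideal.one_imp_carrier primeideal.I_notcarr primeideal.axioms(1) by metis
  thus ?case by (auto simp: ideal.Quot_one_eq[OF K] intro!: bexI[of _ \<one>])
next
  case (Cons x xs)
  then obtain b where b: "b \<in> carrier R" "b \<notin> PIdl p"
    and eq: "foldr (\<otimes>\<^bsub>R Quot K\<^esub>) xs \<one>\<^bsub>R Quot K\<^esub> = K +> (p [^] count_list xs (K +> p) \<otimes> b)"
    by auto
  show ?case
  proof (cases "x = K +> p")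
    case True
    hence "foldr (\<otimes>\<^bsub>R Quot K\<^esub>) (x # xs) \<one>\<^bsub>R Quot K\<^esub> =
        K +> (p [^] count_list (x # xs) (K +> p) \<otimes> b)"
      using eq p(2) b(1) by (simp add: ideal.Quot_mult_eq[OF K] m_ac)
    thus ?thesis using b by blast
  next
    case False
    then obtain c where c: "c \<in> carrier R" "c \<notin> PIdl p" "x = K +> c" using Cons.prems by auto
    have "b \<otimes> c \<notin> PIdl p" using primeideal.I_prime[OF p(1) b(1) c(1)] b(2) c(2) by blast
    moreover have "foldr (\<otimes>\<^bsub>R Quot K\<^esub>) (x # xs) \<one>\<^bsub>R Quot K\<^esub> =
        K +> (p [^] count_list (x # xs) (K +> p) \<otimes> (b \<otimes> c))"
      using eq False c p(2) b(1) by (simp add: ideal.Quot_mult_eq[OF K] m_ac)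
    ultimately show ?thesis using b(1) c(1) by blast
  qed
qed

lemma erdos_burgess_Quot_ge:
  assumes fact: "prime_ideal_factorization R K A n" and K: "ideal K R" "K \<noteq> {\<zero>}"
  shows "enat (davenport (units_of (R Quot K)) + (\<Sum>P\<in>A. n P) - card A) \<le> erdos_burgess (R Quot K)"
proof -
  let ?Q = "R Quot K"
  interpret K: ideal K R by fact
  interpret Q: cring ?Q by (rule K.quotient_is_cring[OF is_cring])
  have fin: "finite A" and A: "\<And>P. P \<in> A \<Longrightarrow> primeideal P R" "\<And>P. P \<in> A \<Longrightarrow> 1 \<le> n P"
    using fact unfolding prime_ideal_factorization_def by auto
  obtain g where g: "\<And>P. P \<in> A \<Longrightarrow> g P \<in> carrier R" "\<And>P. P \<in> A \<Longrightarrow> g P \<noteq> \<zero>"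
    "\<And>P. P \<in> A \<Longrightarrow> PIdl (g P) = P"
    using factorization_generators[OF fact K(2)] by metis
  have K_sub: "K \<subseteq> PIdl (g P [^] n P)" "K \<subseteq> P" if "P \<in> A" for P
    using factorization_subset_iff[OF fact K(2), of "g P"] A[OF that] g[OF that] that nat_pow_eone[of "g P"]
    by (metis order_refl)+
  have g_in: "g P \<in> P" if "P \<in> A" for P using cgenideal_self[OF g(1)[OF that]] g(3)[OF that] by simp
  have g_notin: "g P \<notin> P'" if "P \<in> A" "P' \<in> A" "P \<noteq> P'" for P P'
    using prime_generator_notin[of "g P" P'] g[OF that(1)] A that by auto
  \<comment> \<open>Distinct primes give distinct classes modulo \<open>K\<close>, so the
    multiplicity of each class in \<open>M\<close> is exactly \<open>n P - 1\<close>.\<close>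
  have g_inj: "P = P'" if "P \<in> A" "P' \<in> A" "K +> g P = K +> g P'" for P P'
  proof (rule ccontr)
    assume "P \<noteq> P'"
    have "g P \<ominus> g P' \<in> P'" using that K.Quot_eq_iff g(1) K_sub(2) by blast
    moreover interpret P': ideal P' R using A(1)[OF that(2)] by (rule primeideal.axioms(1))
    have "g P' \<in> P'" using g_in that by blast
    ultimately have "(g P \<ominus> g P') \<oplus> g P' \<in> P'" by (rule P'.a_closed)
    moreover have "(g P \<ominus> g P') \<oplus> g P' = g P" using g(1)[OF that(1)] g(1)[OF that(2)] by algebra
    ultimately show False using g_notin[OF that(1,2) \<open>P \<noteq> P'\<close>] by simp
  qed
  obtain T0 where T0: "set T0 \<subseteq> Units ?Q" "davenport (units_of ?Q) \<le> Suc (length T0)"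
      "\<And>xs. xs \<noteq> [] \<Longrightarrow> mset xs \<subseteq># mset T0 \<Longrightarrow> seq_prod ?Q xs \<noteq> \<one>\<^bsub>?Q\<^esub>"
    using ex_product_one_free[of "units_of ?Q"]
    by (auto simp: seq_prod_units_of units_of_one units_of_carrier)
  define M where "M = (\<Sum>P\<in>A. replicate_mset (n P - 1) (K +> g P))"
  obtain T where T: "mset T = mset T0 + M" using ex_mset by blast
  have "size (\<Sum>P\<in>B. replicate_mset (n P - 1) (K +> g P)) = (\<Sum>P\<in>B. n P - 1)" for B
    by (induction B rule: infinite_finite_induct) auto
  hence "size M = (\<Sum>P\<in>A. n P - 1)" unfolding M_def by blast
  also have "\<dots> = (\<Sum>P\<in>A. n P) - card A" using A(2) by (subst sum_subtractf_nat) auto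
  finally have sizeM: "size M = (\<Sum>P\<in>A. n P) - card A" .
  \<comment> \<open>Makes the truncated subtraction in the bound exact; the extremal sequence is
    then at most one shorter than the bound.\<close>
  have card_le: "card A \<le> (\<Sum>P\<in>A. n P)" using sum_mono[of A "\<lambda>_. 1" n] A(2) by simp
  have lenT: "davenport (units_of ?Q) + (\<Sum>P\<in>A. n P) - card A \<le> Suc (length T)"
    using arg_cong[OF T, of size] sizeM T0(2) card_le by simp
  have countM: "count M x = (\<Sum>P\<in>A. if K +> g P = x then n P - 1 else 0)" for x
    unfolding M_def by (auto simp: count_sum intro!: sum.cong)
  have setM: "\<exists>P\<in>A. x = K +> g P" if "x \<in># M" for x
    using that fin unfolding M_def by (auto simp: set_mset_sum split: if_splits)
  have countMP: "count M (K +> g P) = n P - 1" if "P \<in> A" for P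
  proof -
    have "count M (K +> g P) = (\<Sum>P'\<in>A. if P = P' then n P' - 1 else 0)"
      unfolding countM using g_inj that by (intro sum.cong) auto
    thus ?thesis using fin that by simp
  qed
  have setT: "set T = set T0 \<union> set_mset M"
    using arg_cong[OF T, of set_mset] by simp
  have T_carr: "set T \<subseteq> carrier ?Q"
  proof
    fix x assume "x \<in> set T"
    then consider "x \<in> set T0" | "x \<in># M" unfolding setT by blast
    thus "x \<in> carrier ?Q"
    proof cases
      case 1
      thus ?thesis using T0(1) Q.Units_closed by blast
    next
      case 2
      then obtain P where "P \<in> A" "x = K +> g P" using setM by blast
      thus ?thesis using g(1) by (simp add: K.Quot_carrier_eq)
    qed
  qed
  have "idempotent_product_free ?Q T"
    unfolding idempotent_product_free_def
  proof safe
    fix xs assume ne: "xs \<noteq> []" and sub: "mset xs \<subseteq># mset T"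
      and idem: "seq_prod ?Q xs \<otimes>\<^bsub>?Q\<^esub> seq_prod ?Q xs = seq_prod ?Q xs"
    have xs_T: "set xs \<subseteq> set T" using sub by (rule subseteq_mset_set)
    hence foldr: "seq_prod ?Q xs = foldr (\<otimes>\<^bsub>?Q\<^esub>) xs \<one>\<^bsub>?Q\<^esub>"
      using Q.seq_prod_eq_foldr[OF ne] T_carr by blast
    show False
    proof (cases "\<exists>P\<in>A. K +> g P \<in> set xs")
      case True
      then obtain P where P: "P \<in> A" "K +> g P \<in> set xs" by blast
      define p where "p = g P"
      have p: "primeideal (PIdl p) R" "p \<in> carrier R" "p \<noteq> \<zero>" "PIdl p = P" "K +> p \<in> set xs"
        using A(1) g P by (auto simp: p_def)
      define c where "c = count_list xs (K +> p)"
      have "c \<le> count (mset T) (K +> p)" 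
        using mset_subset_eq_count[OF sub] unfolding c_def count_mset[symmetric] .
      \<comment> \<open>The class of \<open>p\<close> is a nonunit, so all its occurrences in
        \<open>T\<close> come from \<open>M\<close>.\<close>
      moreover have "K +> p \<notin> set T0"
        using T0(1) Quot_notin_Units[OF K(1) A(1)[OF P(1)] K_sub(2)[OF P(1)] g_in[OF P(1)]]
        by (auto simp: p_def)
      hence "count (mset T) (K +> p) = n P - 1"
        using countMP[OF P(1)] unfolding T by (simp add: p_def count_list_0_iff)
      ultimately have "c \<le> n P - 1" by simp
      hence c_less: "c < n P" using A(2)[OF P(1)] by linarith
      have "c \<noteq> 0" using p(5) by (simp add: c_def count_list_0_iff)
      then obtain c' where c': "c = Suc c'" by (cases c) auto
      \<comment> \<open>The remaining terms are units or classes of generators of other primes; both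
        have representatives outside \<open>P\<close>.\<close>
      have "\<exists>b\<in>carrier R - PIdl p. x = K +> b" if x: "x \<in> set xs" "x \<noteq> K +> p" for x
      proof (cases "x \<in> set T0")
        case True
        then obtain b where b: "b \<in> carrier R" "x = K +> b"
          using T0(1) by (auto simp: Units_def K.Quot_carrier_eq)
        have "b \<notin> P"
          using Quot_notin_Units[OF K(1) A(1)[OF P(1)] K_sub(2)[OF P(1)]] T0(1) True b(2) by blast
        thus ?thesis using b p(4) by blast
      next
        case False
        then obtain P' where P': "P' \<in> A" "x = K +> g P'" using setM setT xs_T x(1) by blast
        hence "g P' \<notin> P" using g_notin[OF P'(1) P(1)] x(2) by (auto simp: p_def)
        thus ?thesis using P' g(1) p(4) by blast
      qed
      then obtain b where b: "b \<in> carrier R" "b \<notin> PIdl p"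
        and prod: "seq_prod ?Q xs = K +> (p [^] c \<otimes> b)"
        using Quot_prod_prime_split[OF K(1) p(1,2), of xs] foldr by (auto simp: c_def)
      define e where "e = p [^] c \<otimes> b"
      have e: "e \<in> carrier R" using p(2) b(1) by (simp add: e_def)
      have "K +> (e \<otimes> e) = K +> e" using idem prod e by (simp add: e_def K.Quot_mult_eq)
      hence "e \<otimes> e \<ominus> e \<in> K" using K.Quot_eq_iff[of "e \<otimes> e" e] e by simp
      moreover have "e \<otimes> e \<ominus> e = e \<otimes> (e \<ominus> \<one>)" using e by algebra
      \<comment> \<open>As \<open>c\<close> is positive, \<open>e\<close> lies in
        \<open>PIdl p\<close> and \<open>e \<ominus> \<one>\<close> does not. Cancelling
        \<open>e \<ominus> \<one>\<close> and then \<open>b\<close> leaves \<open>p [^] c\<close> in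
        \<open>PIdl (p [^] n P)\<close>, against \<open>c < n P\<close>.\<close>
      ultimately have mem: "e \<otimes> (e \<ominus> \<one>) \<in> PIdl (p [^] n P)"
        using K_sub(1)[OF P(1)] by (auto simp: p_def)
      interpret P: primeideal "PIdl p" R by (rule p(1))
      have "e = (p [^] c' \<otimes> b) \<otimes> p" using p(2) b(1) by (simp add: e_def c' m_ac)
      hence eP: "e \<in> PIdl p" using p(2) b(1) by (auto simp: cgenideal_mem_iff)
      have "e \<ominus> \<one> \<notin> PIdl p"
      proof
        assume "e \<ominus> \<one> \<in> PIdl p"
        hence "e \<oplus> \<ominus> (e \<ominus> \<one>) \<in> PIdl p" using eP P.a_closed P.a_inv_closed by blast
        moreover have "e \<oplus> \<ominus> (e \<ominus> \<one>) = \<one>" using e by algebra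
        ultimately show False using P.one_imp_carrier P.I_notcarr by simp
      qed
      hence "e \<in> PIdl (p [^] n P)"
        using prime_power_mem_cancel[OF p(1-3), of "e \<ominus> \<one>" e "n P"] mem e by simp
      hence "p [^] c \<in> PIdl (p [^] n P)"
        using prime_power_mem_cancel[OF p(1-3) b, of "p [^] c" "n P"] p(2) by (simp add: e_def)
      thus False using prime_power_mem_iff[OF p(1-3)] c_less by simp
    next
      case False
      \<comment> \<open>Without classes from \<open>M\<close> the product is a unit. An idempotent
        unit is one, which the choice of \<open>T0\<close> forbids.\<close>
      have "mset xs \<subseteq># mset T0"
      proof (rule mset_subset_eqI)
        fix x
        show "count (mset xs) x \<le> count (mset T0) x"
        proof (cases "x \<in> set xs")
          case True
          hence "x \<notin># M" using False setM by blast
          hence "count M x = 0" by (simp add: count_eq_zero_iff)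
          thus ?thesis using mset_subset_eq_count[OF sub, of x] unfolding T by simp
        next
          case False
          thus ?thesis by (metis count_mset_0_iff le0)
        qed
      qed
      hence sub0: "set xs \<subseteq> Units ?Q" "seq_prod ?Q xs \<noteq> \<one>\<^bsub>?Q\<^esub>"
        using T0(1) subseteq_mset_set T0(3)[OF ne] by blast+
      have "foldr (\<otimes>\<^bsub>?Q\<^esub>) xs \<one>\<^bsub>?Q\<^esub> \<in> Units ?Q"
        using sub0(1) by (induction xs) auto
      hence "seq_prod ?Q xs = \<one>\<^bsub>?Q\<^esub>"
        using idem foldr Q.Units_l_cancel[of "seq_prod ?Q xs" "seq_prod ?Q xs" "\<one>\<^bsub>?Q\<^esub>"] by auto
      thus False using sub0(2) by blast
    qed
  qed
  hence "enat (length T) < erdos_burgess ?Q" using erdos_burgess_greater T_carr by blast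
  hence "enat (Suc (length T)) \<le> erdos_burgess ?Q" by (metis Suc_ile_eq)
  thus ?thesis using lenT by (meson enat_ord_simps(1) order_trans)
qed

section \<open>The upper bound for prime powers\<close>

lemma Quot_prod_mem_power:
  assumes K: "ideal K R" and p: "p \<in> carrier R"
    and xs: "\<And>x. x \<in> set xs \<Longrightarrow> \<exists>a\<in>PIdl p. x = K +> a"
  shows "\<exists>c\<in>PIdl (p [^] length xs). foldr (\<otimes>\<^bsub>R Quot K\<^esub>) xs \<one>\<^bsub>R Quot K\<^esub> = K +> c"
  using xs
proof (induction xs)
  case Nil
  thus ?case by (auto simp: cgenideal_one ideal.Quot_one_eq[OF K])
next
  case (Cons x xs)
  then obtain a c where a: "a \<in> PIdl p" "x = K +> a" and c: "c \<in> PIdl (p [^] length xs)"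
    "foldr (\<otimes>\<^bsub>R Quot K\<^esub>) xs \<one>\<^bsub>R Quot K\<^esub> = K +> c"
    by (metis list.set_intros(1,2))
  obtain r s where rs: "r \<in> carrier R" "s \<in> carrier R" "a = r \<otimes> p" "c = s \<otimes> p [^] length xs"
    using a c by (auto simp: cgenideal_mem_iff)
  have "a \<otimes> c = (r \<otimes> s) \<otimes> p [^] length (x # xs)" using rs p by (simp add: m_ac)
  hence "a \<otimes> c \<in> PIdl (p [^] length (x # xs))" using rs(1,2) unfolding cgenideal_mem_iff by blast
  moreover have "foldr (\<otimes>\<^bsub>R Quot K\<^esub>) (x # xs) \<one>\<^bsub>R Quot K\<^esub> = K +> (a \<otimes> c)"
    using a(2) c(2) rs p by (simp add: ideal.Quot_mult_eq[OF K])
  ultimately show ?case by blast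
qed

text \<open>A repetition among the powers of the class of \<open>a\<close>, pulled back to
  \<open>R\<close>. At a prime containing \<open>K\<close> it leaves two options: \<open>a\<close>
  lies in the prime, or \<open>a [^] Suc m\<close> is one modulo it.\<close>

lemma Quot_finite_pow_diff_mem:
  assumes K: "ideal K R" and fin: "finite (carrier (R Quot K))" and a: "a \<in> carrier R"
  obtains i m :: nat where "a [^] i \<otimes> (a [^] Suc m \<ominus> \<one>) \<in> K"
proof -
  interpret K: ideal K R by fact
  interpret Q: cring "R Quot K" by (rule K.quotient_is_cring[OF is_cring])
  have "K +> a \<in> carrier (R Quot K)" using a by (simp add: K.Quot_carrier_eq)
  then obtain i m :: nat where "(K +> a) [^]\<^bsub>R Quot K\<^esub> (i + Suc m) = (K +> a) [^]\<^bsub>R Quot K\<^esub> i"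
    using Q.finite_pow_eq[OF fin] by blast
  hence "K +> (a [^] (i + Suc m)) = K +> (a [^] i)" using a by (simp only: K.Quot_pow_eq)
  hence "a [^] (i + Suc m) \<ominus> a [^] i \<in> K"
    using K.Quot_eq_iff[of "a [^] (i + Suc m)" "a [^] i"] a by blast
  also have "a [^] (i + Suc m) = a [^] i \<otimes> a [^] Suc m" using a by (simp only: nat_pow_mult)
  also have "a [^] i \<otimes> a [^] Suc m \<ominus> a [^] i = a [^] i \<otimes> (a [^] Suc m \<ominus> \<one>)"
    using a nat_pow_closed[OF a, of i] nat_pow_closed[OF a, of "Suc m"] by algebra
  finally show ?thesis using that by blast
qed

text \<open>With exponent \<open>Suc k\<close> and a single prime, \<open>k\<close> is the
  difference of the two factor counts; \<open>k + 1\<close> nonunits already multiply to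
  zero.\<close>

lemma erdos_burgess_Quot_prime_power_le:
  assumes fin: "finite (carrier (R Quot K))"
    and p: "primeideal (PIdl p) R" "p \<in> carrier R" "p \<noteq> \<zero>" and K_eq: "K = PIdl (p [^] Suc k)"
  shows "erdos_burgess (R Quot K) \<le> enat (davenport (units_of (R Quot K)) + k)"
proof -
  have K: "ideal K R" using p(2) by (simp add: K_eq cgenideal_ideal)
  interpret K: ideal K R by fact
  interpret Q: cring "R Quot K" by (rule K.quotient_is_cring[OF is_cring])
  have nonunit: "\<exists>a\<in>PIdl p. x = K +> a"
    if x: "x \<in> carrier (R Quot K) - Units (R Quot K)" for x
  proof -
    obtain a where a: "a \<in> carrier R" "x = K +> a" using x by (auto simp: K.Quot_carrier_eq)
    have "a \<in> PIdl p"
    proof (rule ccontr)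
      \<comment> \<open>Then the factor \<open>a [^] i\<close> can be cancelled modulo
        \<open>K\<close>, and the class of \<open>a [^] m\<close> becomes an inverse of
        \<open>x\<close>.\<close>
      assume "a \<notin> PIdl p"
      hence notin: "a [^] i \<notin> PIdl p" for i :: nat by (rule primeideal_pow_notin[OF p(1) a(1)])
      obtain i m :: nat where im: "a [^] i \<otimes> (a [^] Suc m \<ominus> \<one>) \<in> K"
        using Quot_finite_pow_diff_mem[OF K fin a(1)] by blast
      hence "(a [^] Suc m \<ominus> \<one>) \<otimes> a [^] i \<in> PIdl (p [^] Suc k)"
        unfolding K_eq using a(1) by (simp add: m_comm)
      hence "a [^] Suc m \<ominus> \<one> \<in> K"
        unfolding K_eq using prime_power_mem_cancel[OF p _ notin] a(1) by blast
      hence "K +> (a [^] Suc m) = K +> \<one>" using K.Quot_eq_iff[of "a [^] Suc m" \<one>] a(1) by blast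
      hence "(K +> (a [^] m)) \<otimes>\<^bsub>R Quot K\<^esub> x = \<one>\<^bsub>R Quot K\<^esub>"
        using a by (simp add: K.Quot_mult_eq K.Quot_one_eq)
      moreover have "K +> (a [^] m) \<in> carrier (R Quot K)" "x \<in> carrier (R Quot K)"
        using a(1) x by (simp_all add: K.Quot_carrier_eq)
      ultimately have "x \<in> Units (R Quot K)"
        using Q.m_comm[of x "K +> (a [^] m)"] unfolding Units_def by auto
      thus False using x by blast
    qed
    thus ?thesis using a by blast
  qed
  show ?thesis
  proof (rule Q.erdos_burgess_le_of_nonunits[OF fin])
    fix xs assume xs: "set xs \<subseteq> carrier (R Quot K) - Units (R Quot K)" "Suc k \<le> length xs"
    obtain c where c: "c \<in> PIdl (p [^] length xs)"
      "foldr (\<otimes>\<^bsub>R Quot K\<^esub>) xs \<one>\<^bsub>R Quot K\<^esub> = K +> c"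
      using Quot_prod_mem_power[OF K p(2), of xs] nonunit xs(1) by blast
    have "p [^] length xs \<in> K" using prime_power_mem_iff[OF p] xs(2) K_eq by blast
    hence "PIdl (p [^] length xs) \<subseteq> K" by (rule cgenideal_minimal[OF K])
    hence "K +> c = K" using c(1) K.a_rcos_const by blast
    moreover have "xs \<noteq> []" using xs(2) by auto
    ultimately have "seq_prod (R Quot K) xs = \<zero>\<^bsub>R Quot K\<^esub>"
      using Q.seq_prod_eq_foldr[of xs] xs(1) c(2) by (auto simp: K.Quot_zero_eq)
    thus "seq_prod (R Quot K) xs \<otimes>\<^bsub>R Quot K\<^esub> seq_prod (R Quot K) xs = seq_prod (R Quot K) xs"
      by simp
  qed
qed

section \<open>The upper bound for squarefree ideals\<close>

text \<open>Primes are divided out of \<open>x\<close> one at a time: the product of the generators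
  treated so far avoids the next prime, so the cofactor must lie in it.\<close>

lemma squarefree_factorization_mem_iff:
  assumes fact: "prime_ideal_factorization R K A (\<lambda>_. 1)" and K: "K \<noteq> {\<zero>}" and x: "x \<in> carrier R"
  shows "x \<in> K \<longleftrightarrow> (\<forall>P\<in>A. x \<in> P)"
proof -
  have fin: "finite A" and A: "\<And>P. P \<in> A \<Longrightarrow> primeideal P R"
    using fact unfolding prime_ideal_factorization_def by auto
  obtain g where g: "\<And>P. P \<in> A \<Longrightarrow> g P \<in> carrier R" "\<And>P. P \<in> A \<Longrightarrow> g P \<noteq> \<zero>"
    "\<And>P. P \<in> A \<Longrightarrow> PIdl (g P) = P" and Kg: "K = PIdl (\<Otimes>P\<in>A. g P [^] (1::nat))"
    using factorization_generators[OF fact K] by metis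
  have K_sub: "K \<subseteq> P" if "P \<in> A" for P
    using factorization_subset_iff[OF fact K, of "g P" 1] A[OF that] g[OF that] that by simp
  have "x \<in> PIdl (\<Otimes>P\<in>B. g P)" if "B \<subseteq> A" "\<forall>P\<in>B. x \<in> P" for B
    using finite_subset[OF that(1) fin] that
  proof (induction B rule: finite_induct)
    case empty
    thus ?case using x by (simp add: cgenideal_one)
  next
    case (insert P B)
    let ?G = "\<Otimes>P\<in>B. g P"
    have P: "P \<in> A" "x \<in> P" and B: "B \<subseteq> A" using insert.prems by auto
    have G: "?G \<in> carrier R" using B g(1) by (intro finprod_closed) auto
    obtain r where r: "r \<in> carrier R" "x = r \<otimes> ?G" using insert by (auto simp: cgenideal_mem_iff)
    have "g P' \<notin> P" if "P' \<in> B" for P'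
    proof -
      have "P' \<in> A" "P' \<noteq> P" using that B insert.hyps by auto
      thus ?thesis using prime_generator_notin[of "g P'" P] g[of P'] A A[OF P(1)] by simp
    qed
    hence "?G \<notin> P" using A[OF P(1)] insert.hyps(1) B g(1) by (intro primeideal_finprod_notin) auto
    hence "r \<in> P" using primeideal.I_prime[OF A[OF P(1)] r(1) G] P(2) r(2) by blast
    then obtain s where s: "s \<in> carrier R" "r = s \<otimes> g P" using g(3)[OF P(1)] cgenideal_mem_iff by blast
    have "(\<Otimes>P\<in>insert P B. g P) = g P \<otimes> ?G"
      using insert.hyps g(1) P(1) B by (subst finprod_insert) auto
    moreover have "x = s \<otimes> (g P \<otimes> ?G)" using r(2) s G g(1)[OF P(1)] by (simp add: m_assoc)
    ultimately show ?case using s(1) by (auto simp: cgenideal_mem_iff)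
  qed
  moreover have "(\<Otimes>P\<in>A. g P [^] (1::nat)) = (\<Otimes>P\<in>A. g P)"
    using g(1) by (intro finprod_cong') auto
  ultimately show ?thesis using Kg K_sub by auto
qed

text \<open>Primality at each \<open>P\<close> turns \<open>a [^] i\<close> in the repetition of
  powers into \<open>a\<close>. As \<open>K\<close> is the intersection of its primes,
  \<open>x [^] Suc (Suc m) = x\<close> follows in the quotient, and
  \<open>unit_idempotent_decomp\<close> applies.\<close>

lemma erdos_burgess_Quot_squarefree_le:
  assumes fin: "finite (carrier (R Quot K))" and K: "ideal K R" "K \<noteq> {\<zero>}"
    and fact: "prime_ideal_factorization R K A (\<lambda>_. 1)"
  shows "erdos_burgess (R Quot K) \<le> enat (davenport (units_of (R Quot K)))"
proof -
  interpret K: ideal K R by fact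
  interpret Q: cring "R Quot K" by (rule K.quotient_is_cring[OF is_cring])
  have A: "\<And>P. P \<in> A \<Longrightarrow> primeideal P R"
    using fact unfolding prime_ideal_factorization_def by auto
  show ?thesis
  proof (rule Q.erdos_burgess_le_of_unit_idempotent[OF fin])
    fix x assume x: "x \<in> carrier (R Quot K)"
    obtain a where a: "a \<in> carrier R" "x = K +> a" using x by (auto simp: K.Quot_carrier_eq)
    obtain i m :: nat where im: "a [^] i \<otimes> (a [^] Suc m \<ominus> \<one>) \<in> K"
      using Quot_finite_pow_diff_mem[OF K(1) fin a(1)] by blast
    have d: "a [^] Suc m \<ominus> \<one> \<in> carrier R" using a(1) by simp
    have "a \<otimes> (a [^] Suc m \<ominus> \<one>) \<in> P" if P: "P \<in> A" for P
    proof -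
      interpret P: primeideal P R by (rule A[OF P])
      have "a [^] i \<otimes> (a [^] Suc m \<ominus> \<one>) \<in> P"
        using iffD1[OF squarefree_factorization_mem_iff[OF fact K(2) K.Icarr[OF im]] im] P by (rule bspec)
      hence "a [^] i \<in> P \<or> a [^] Suc m \<ominus> \<one> \<in> P"
        by (rule P.I_prime[OF nat_pow_closed[OF a(1)] d])
      hence "a \<in> P \<or> a [^] Suc m \<ominus> \<one> \<in> P" using primeideal_pow_notin[OF A[OF P] a(1)] by blast
      thus ?thesis using P.I_l_closed[OF _ a(1)] P.I_r_closed[OF _ d] by blast
    qed
    hence "a \<otimes> (a [^] Suc m \<ominus> \<one>) \<in> K"
      using squarefree_factorization_mem_iff[OF fact K(2) m_closed[OF a(1) d]] by blast
    moreover have "a \<otimes> (a [^] Suc m \<ominus> \<one>) = a [^] Suc m \<otimes> a \<ominus> a"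
      using a(1) nat_pow_closed[OF a(1), of "Suc m"] by algebra
    ultimately have "K +> (a [^] Suc (Suc m)) = K +> a"
      using K.Quot_eq_iff[of "a [^] Suc (Suc m)" a] a(1) by simp
    hence "x [^]\<^bsub>R Quot K\<^esub> Suc (Suc m) = x"
      using K.Quot_pow_eq[OF a(1), of "Suc (Suc m)"] a(2) by simp
    thus "\<exists>u\<in>Units (R Quot K). \<exists>e\<in>carrier (R Quot K). e \<otimes>\<^bsub>R Quot K\<^esub> e = e \<and> x = u \<otimes>\<^bsub>R Quot K\<^esub> e"
      by (rule Q.unit_idempotent_decomp[OF x])
  qed
qed

end

section \<open>Polynomial rings over a finite field\<close>

text \<open>Each coset contains a remainder modulo a fixed nonzero \<open>f\<close> in
  \<open>K\<close>. Polynomials are coefficient lists, and a finite field has only finitely many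
  lists of bounded length.\<close>

lemma (in field) finite_poly_ring_Quot:
  assumes fin: "finite (carrier R)" and K: "ideal K (poly_ring R)" "K \<noteq> {\<zero>\<^bsub>poly_ring R\<^esub>}"
  shows "finite (carrier (poly_ring R Quot K))"
proof -
  have sf: "subfield (carrier R) R" by (rule carrier_is_subfield)
  interpret UP: principal_domain "poly_ring R" by (rule univ_poly_is_principal[OF sf])
  interpret K: ideal K "poly_ring R" by fact
  obtain f where f: "f \<in> K" "f \<noteq> \<zero>\<^bsub>poly_ring R\<^esub>" using K(2) K.zero_closed by blast
  have fc: "f \<in> carrier (poly_ring R)" using f(1) by (rule K.Icarr)
  let ?B = "{xs. set xs \<subseteq> carrier R \<and> length xs \<le> length f}"
  have "carrier (poly_ring R Quot K) \<subseteq> (\<lambda>a. K +>\<^bsub>poly_ring R\<^esub> a) ` ?B"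
  proof
    fix x assume "x \<in> carrier (poly_ring R Quot K)"
    then obtain a where a: "a \<in> carrier (poly_ring R)" "x = K +>\<^bsub>poly_ring R\<^esub> a"
      by (auto simp: K.Quot_carrier_eq)
    let ?d = "a pdiv f" and ?r = "a pmod f"
    have c: "?d \<in> carrier (poly_ring R)" "?r \<in> carrier (poly_ring R)"
      using long_division_closed[OF sf a(1) fc] by auto
    have "a = f \<otimes>\<^bsub>poly_ring R\<^esub> ?d \<oplus>\<^bsub>poly_ring R\<^esub> ?r" by (rule pdiv_pmod[OF sf a(1) fc])
    moreover have "(f \<otimes>\<^bsub>poly_ring R\<^esub> ?d \<oplus>\<^bsub>poly_ring R\<^esub> ?r) \<ominus>\<^bsub>poly_ring R\<^esub> ?r = f \<otimes>\<^bsub>poly_ring R\<^esub> ?d"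
      using c fc by (simp add: UP.minus_eq UP.a_assoc UP.r_neg)
    ultimately have "a \<ominus>\<^bsub>poly_ring R\<^esub> ?r = f \<otimes>\<^bsub>poly_ring R\<^esub> ?d" by simp
    hence "a \<ominus>\<^bsub>poly_ring R\<^esub> ?r \<in> K" using K.I_r_closed[OF f(1) c(1)] by simp
    hence "x = K +>\<^bsub>poly_ring R\<^esub> ?r" using K.Quot_eq_iff[OF a(1) c(2)] a(2) by simp
    moreover have "set ?r \<subseteq> carrier R"
      using c(2) polynomial_in_carrier[OF carrier_is_subring] univ_poly_carrier by blast
    moreover have "length ?r \<le> length f"
      using pmod_degree[OF sf a(1) fc] f(2) by (auto simp: univ_poly_zero)
    ultimately show "x \<in> (\<lambda>a. K +>\<^bsub>poly_ring R\<^esub> a) ` ?B" by blast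
  qed
  moreover have "finite ?B" using fin by (rule finite_lists_length_le)
  ultimately show ?thesis using finite_surj by blast
qed

text \<open>For the zero ideal the two counts are unspecified; the lower bound holds there because
  the left side is infinite, and the last conjunct records this value. The unit ideal is covered by
  the product over the empty set.\<close>

theorem theorem1p1:
  fixes F :: "('a, 'b) ring_scheme"
    and q :: nat
    and K :: "'a list set"
    and R :: "'a list set ring"
  assumes "primepow q"
    and "field F" and "finite (carrier F)" and "card (carrier F) = q"
    and "ideal K (poly_ring F)"
    and "R = poly_ring F Quot K"
  shows "erdos_burgess R \<ge>
           enat (davenport (units_of R) + ideal_Omega (poly_ring F) K - ideal_omega (poly_ring F) K)
         \<and>
         (K \<noteq> {\<zero>\<^bsub>poly_ring F\<^esub>} \<and>
          ((\<exists>P n. primeideal P (poly_ring F) \<and> n \<ge> (1::nat) \<and>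
                  K = P [^]\<^bsub>ideals_set (poly_ring F)\<^esub> n) \<or>
           (\<exists>A. finite A \<and> (\<forall>P\<in>A. primeideal P (poly_ring F)) \<and>
                K = (\<Otimes>\<^bsub>ideals_set (poly_ring F)\<^esub>P\<in>A. P)))
          \<longrightarrow> erdos_burgess R =
               enat (davenport (units_of R) + ideal_Omega (poly_ring F) K - ideal_omega (poly_ring F) K))
         \<and>
         (K = {\<zero>\<^bsub>poly_ring F\<^esub>} \<longrightarrow> erdos_burgess R = \<infinity>)"
proof -
  interpret F: field F by fact
  interpret UP: principal_domain "poly_ring F" by (rule F.univ_poly_is_principal[OF F.carrier_is_subfield])
  interpret I: comm_monoid "ideals_set (poly_ring F)" by (rule UP.ideals_set_is_comm_monoid)
  note K = assms(5) and R = assms(6)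
  show ?thesis
  proof (cases "K = {\<zero>\<^bsub>poly_ring F\<^esub>}")
    case True
    \<comment> \<open>The coefficient list of the indeterminate, which is nonzero and not a
      unit.\<close>
    have "[\<one>\<^bsub>F\<^esub>, \<zero>\<^bsub>F\<^esub>] \<in> carrier (poly_ring F)"
      by (simp add: univ_poly_carrier[symmetric] polynomial_def)
    moreover have "[\<one>\<^bsub>F\<^esub>, \<zero>\<^bsub>F\<^esub>] \<noteq> \<zero>\<^bsub>poly_ring F\<^esub>" by (simp add: univ_poly_zero)
    moreover have "[\<one>\<^bsub>F\<^esub>, \<zero>\<^bsub>F\<^esub>] \<notin> Units (poly_ring F)"
      using F.univ_poly_carrier_units by auto
    ultimately have "erdos_burgess R = \<infinity>"
      unfolding R True by (rule UP.erdos_burgess_Quot_zero)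
    thus ?thesis using True by simp
  next
    case False
    have fin: "finite (carrier R)" unfolding R using F.finite_poly_ring_Quot assms(3) K False by blast
    obtain A n where fact: "prime_ideal_factorization (poly_ring F) K A n"
      using UP.factorization_exists[OF K False] by blast
    have lower: "enat (davenport (units_of R) + ideal_Omega (poly_ring F) K - ideal_omega (poly_ring F) K)
        \<le> erdos_burgess R"
      unfolding UP.ideal_Omega_eq[OF fact False] UP.ideal_omega_eq[OF fact False] R
      by (rule UP.erdos_burgess_Quot_ge[OF fact K False])
    have upper: "erdos_burgess R \<le>
        enat (davenport (units_of R) + ideal_Omega (poly_ring F) K - ideal_omega (poly_ring F) K)"
      if "(\<exists>P n. primeideal P (poly_ring F) \<and> n \<ge> (1::nat) \<and>
             K = P [^]\<^bsub>ideals_set (poly_ring F)\<^esub> n) \<or>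
          (\<exists>A. finite A \<and> (\<forall>P\<in>A. primeideal P (poly_ring F)) \<and>
             K = (\<Otimes>\<^bsub>ideals_set (poly_ring F)\<^esub>P\<in>A. P))"
      using that
    proof (elim disjE exE conjE)
      fix P and n :: nat
      assume P: "primeideal P (poly_ring F)" "1 \<le> n" "K = P [^]\<^bsub>ideals_set (poly_ring F)\<^esub> n"
      obtain k where n: "n = Suc k" using P(2) by (cases n) auto
      have Pc: "P \<in> carrier (ideals_set (poly_ring F))"
        using P(1) by (simp add: UP.carrier_ideals_set primeideal.axioms(1))
      hence fact: "prime_ideal_factorization (poly_ring F) K {P} (\<lambda>_. n)"
        using P by (simp add: prime_ideal_factorization_def)
      obtain g where g: "g P \<in> carrier (poly_ring F)" "g P \<noteq> \<zero>\<^bsub>poly_ring F\<^esub>"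
          "P = PIdl\<^bsub>poly_ring F\<^esub> (g P)"
        using UP.factorization_generators[OF fact False] by (metis singletonI)
      have "K = PIdl\<^bsub>poly_ring F\<^esub> (g P [^]\<^bsub>poly_ring F\<^esub> Suc k)"
        using UP.cgenideal_pow[OF g(1), of n] P(3) g(3) n by simp
      hence "erdos_burgess R \<le> enat (davenport (units_of R) + k)"
        using UP.erdos_burgess_Quot_prime_power_le[of K "g P" k] fin P(1) g R by simp
      thus ?thesis
        using UP.ideal_Omega_eq[OF fact False] UP.ideal_omega_eq[OF fact False] n by simp
    next
      fix A assume A: "finite A" "\<forall>P\<in>A. primeideal P (poly_ring F)"
        "K = (\<Otimes>\<^bsub>ideals_set (poly_ring F)\<^esub>P\<in>A. P)"
      have Ac: "P \<in> carrier (ideals_set (poly_ring F))" if "P \<in> A" for P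
        using A(2) that by (simp add: UP.carrier_ideals_set primeideal.axioms(1))
      \<comment> \<open>With all exponents equal to one the two counts agree and cancel in the
        bound.\<close>
      hence "K = (\<Otimes>\<^bsub>ideals_set (poly_ring F)\<^esub>P\<in>A. P [^]\<^bsub>ideals_set (poly_ring F)\<^esub> (1::nat))"
        unfolding A(3) by (intro I.finprod_cong') auto
      hence fact: "prime_ideal_factorization (poly_ring F) K A (\<lambda>_. 1)"
        using A by (simp add: prime_ideal_factorization_def)
      have "erdos_burgess R \<le> enat (davenport (units_of R))"
        using UP.erdos_burgess_Quot_squarefree_le[OF _ K False fact] fin R by simp
      thus ?thesis
        using UP.ideal_Omega_eq[OF fact False] UP.ideal_omega_eq[OF fact False] by simp
    qed
    show ?thesis using lower upper False by (auto intro: antisym)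
  qed
qed

end
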